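(* Let $(M,\nabla_M)$ be an $n$-dimensional compact, oriented and complete affine manifold endowed with a linear foliation ${\cal F}_M^U$ of codimension $1$. Suppose that all the leaves of ${\cal F}_M^U$ are simply connected. Then $M$ is homeomorphic to the $n$-dimensional torus $T^n$.
   Context: All manifolds are connected and without boundary. An $n$-dimensional affine manifold $(M,\nabla_M)$ is a smooth $n$-manifold $M$ with a flat torsion-free connection $\nabla_M$ (equivalently, an atlas whose coordinate changes are affine transformations of $\mathbb{R}^n$). Let $p_M:\hat M\to M$ be the universal cover, on which $\pi_1(M)$ acts by deck transformations, $D_M:\hat M\to\mathbb{R}^n$ the developing map (a local diffeomorphism which is affine for the pulled-back connection), $h_M:\pi_1(M)\to Aff(\mathbb{R}^n)$ the holonomy, characterized by $D_M\circ\gamma=h_M(\gamma)\circ D_M$, and $L(h_M):\pi_1(M)\to Gl(\mathbb{R}^n)$ its linear part. $(M,\nabla_M)$ is complete if $\nabla_M$ is geodesically complete, equivalently if $D_M$ is a diffeomorphism. If $U\subset\mathbb{R}^n$ is a vector subspace with $L(h_M)(\gamma)(U)=U$ for all $\gamma\in\pi_1(M)$, the foliation of $\mathbb{R}^n$ by affine subspaces parallel to $U$ pulls back under $D_M$ to a $\pi_1(M)$-invariant foliation ${\cal F}^U_{\hat M}$ of $\hat M$, which is the pullback by $p_M$ of a foliation ${\cal F}^U_M$ of $M$; ${\cal F}^U_M$ is called a linear foliation. Its codimension is $n-\dim U$. *)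

theory Defs
  imports "HOL-Analysis.Analysis"
begin

section \<open>Simply connected spaces, coverings and deck transformations for abstract topologies\<close>

text \<open>
  The library has \<^const>\<open>simply_connected\<close> and \<^const>\<open>covering_space\<close> only for
  sets with the subspace topology of a type class.  The next two definitions are the same
  conditions for an arbitrary \<^typ>\<open>'a topology\<close>.  In particular
  any two loops, hence any two points, have to be homotopic, so that a simply connected
  space is path connected.
\<close>

definition simply_connected_space :: "'a topology \<Rightarrow> bool" where
  "simply_connected_space X \<longleftrightarrow>
     (\<forall>p q. pathin X p \<and> p 1 = p 0 \<and> pathin X q \<and> q 1 = q 0 \<longrightarrow>
        homotopic_with (\<lambda>r. r 1 = r 0) (top_of_set {0..1::real}) X p q)"

definition covering_map :: "'b topology \<Rightarrow> ('b \<Rightarrow> 'a) \<Rightarrow> 'a topology \<Rightarrow> bool" where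
  "covering_map C p X \<longleftrightarrow>
     continuous_map C X p \<and> p ` topspace C = topspace X \<and>
     (\<forall>x \<in> topspace X. \<exists>T. x \<in> T \<and> openin X T \<and>
        (\<exists>\<V>. \<Union>\<V> = topspace C \<inter> p -` T \<and>
             (\<forall>W \<in> \<V>. openin C W) \<and>
             pairwise disjnt \<V> \<and>
             (\<forall>W \<in> \<V>. homeomorphic_map (subtopology C W) (subtopology X T) p)))"

definition universal_cover :: "'b topology \<Rightarrow> ('b \<Rightarrow> 'a) \<Rightarrow> 'a topology \<Rightarrow> bool" where
  "universal_cover C p X \<longleftrightarrow> covering_map C p X \<and> simply_connected_space C"

definition deck_transformations :: "'b topology \<Rightarrow> ('b \<Rightarrow> 'a) \<Rightarrow> ('b \<Rightarrow> 'b) set" where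
  "deck_transformations C p =
     {\<gamma>. homeomorphic_map C C \<gamma> \<and> (\<forall>x \<in> topspace C. p (\<gamma> x) = p x)}"


section \<open>Affine transformations\<close>

definition affine_transformations :: "(real^'n \<Rightarrow> real^'n) set" where
  "affine_transformations = {T. \<exists>L b. linear L \<and> bij L \<and> T = (\<lambda>x. L x + b)}"

definition linear_part :: "(real^'n \<Rightarrow> real^'n) \<Rightarrow> (real^'n \<Rightarrow> real^'n)" where
  "linear_part T = (\<lambda>v. T v - T 0)"

definition positive_affine_transformations :: "(real^'n \<Rightarrow> real^'n) set" where
  "positive_affine_transformations =
     {T \<in> affine_transformations. det (matrix (linear_part T)) > 0}"


section \<open>Affine manifolds\<close>

text \<open>
  A flat torsion-free connection is given by an affine atlas: a set of charts whose
  coordinate changes are, near each point of the overlap (equivalently, on each connected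
  component of it), restrictions of affine transformations.  A chart is its domain together
  with its coordinate map; the values of the map outside the domain are irrelevant.
\<close>

type_synonym ('a, 'n) chart = "'a set \<times> ('a \<Rightarrow> real^'n)"

definition chart_of :: "'a topology \<Rightarrow> ('a, 'n::finite) chart \<Rightarrow> bool" where
  "chart_of M = (\<lambda>(V, \<phi>). openin M V \<and> open (\<phi> ` V) \<and>
     homeomorphic_map (subtopology M V) (top_of_set (\<phi> ` V)) \<phi>)"

definition coordinate_change_in ::
  "(real^'n \<Rightarrow> real^'n) set \<Rightarrow> 'a topology \<Rightarrow> ('a, 'n::finite) chart \<Rightarrow> ('a, 'n) chart \<Rightarrow> bool" where
  "coordinate_change_in G M = (\<lambda>(V, \<phi>) (W, \<psi>).
     \<forall>x \<in> V \<inter> W. \<exists>T \<in> G. \<exists>N. openin M N \<and> x \<in> N \<and> N \<subseteq> V \<inter> W \<and>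
       (\<forall>y \<in> N. \<psi> y = T (\<phi> y)))"

definition atlas_with :: "(real^'n \<Rightarrow> real^'n) set \<Rightarrow> 'a topology \<Rightarrow> ('a, 'n::finite) chart set \<Rightarrow> bool" where
  "atlas_with G M \<A> \<longleftrightarrow>
     (\<forall>c \<in> \<A>. chart_of M c) \<and> (\<Union>c \<in> \<A>. fst c) = topspace M \<and>
     (\<forall>c \<in> \<A>. \<forall>d \<in> \<A>. coordinate_change_in G M c d)"

definition affine_manifold :: "'a topology \<Rightarrow> ('a, 'n::finite) chart set \<Rightarrow> bool" where
  "affine_manifold M \<A> \<longleftrightarrow>
     topspace M \<noteq> {} \<and> connected_space M \<and> Hausdorff_space M \<and> second_countable M \<and>
     atlas_with affine_transformations M \<A>"

text \<open>
  An orientation is given by an oriented atlas of affine charts.  Its charts have to be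
  compatible with those of \<open>\<A>\<close> but need not belong to \<open>\<A>\<close>.
\<close>

definition affine_orientation ::
  "'a topology \<Rightarrow> ('a, 'n::finite) chart set \<Rightarrow> ('a, 'n) chart set \<Rightarrow> bool" where
  "affine_orientation M \<A> \<O> \<longleftrightarrow>
     atlas_with positive_affine_transformations M \<O> \<and>
     (\<forall>c \<in> \<A>. \<forall>d \<in> \<O>. coordinate_change_in affine_transformations M c d)"

text \<open>
  In affine coordinates the Christoffel symbols of the connection vanish, so the geodesics
  are the curves that are locally of the form \<open>s \<mapsto> a + s v\<close> in the charts.
\<close>

definition geodesic_line :: "'a topology \<Rightarrow> ('a, 'n::finite) chart set \<Rightarrow> (real \<Rightarrow> 'a) \<Rightarrow> bool" where
  "geodesic_line M \<A> c \<longleftrightarrow>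
     continuous_map euclideanreal M c \<and>
     (\<forall>(V, \<phi>) \<in> \<A>. \<forall>t. c t \<in> V \<longrightarrow>
        (\<exists>a v. \<forall>\<^sub>F s in nhds t. \<phi> (c s) = a + s *\<^sub>R v))"

definition geodesically_complete :: "'a topology \<Rightarrow> ('a, 'n::finite) chart set \<Rightarrow> bool" where
  "geodesically_complete M \<A> \<longleftrightarrow>
     (\<forall>(V, \<phi>) \<in> \<A>. \<forall>x \<in> V. \<forall>v. \<exists>c. geodesic_line M \<A> c \<and> c 0 = x \<and>
        ((\<lambda>s. \<phi> (c s)) has_vector_derivative v) (at 0))"


section \<open>Developing map, holonomy and linear foliations\<close>

text \<open>
  The maps \<open>\<phi> \<circ> p\<close> are local affine coordinates of the pulled-back connection on the
  universal cover; a developing map has to agree with each of them locally up to an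
  affine transformation.
\<close>

definition developing_map ::
  "('a, 'n::finite) chart set \<Rightarrow> 'b topology \<Rightarrow> ('b \<Rightarrow> 'a) \<Rightarrow> ('b \<Rightarrow> real^'n) \<Rightarrow> bool" where
  "developing_map \<A> C p D \<longleftrightarrow>
     (\<forall>(V, \<phi>) \<in> \<A>. \<forall>x \<in> topspace C. p x \<in> V \<longrightarrow>
        (\<exists>T \<in> affine_transformations. \<exists>N. openin C N \<and> x \<in> N \<and> p ` N \<subseteq> V \<and>
           (\<forall>y \<in> N. D y = T (\<phi> (p y)))))"

definition holonomy ::
  "'b topology \<Rightarrow> ('b \<Rightarrow> 'a) \<Rightarrow> ('b \<Rightarrow> real^'n) \<Rightarrow> (('b \<Rightarrow> 'b) \<Rightarrow> real^'n \<Rightarrow> real^'n::finite) \<Rightarrow> bool" where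
  "holonomy C p D h \<longleftrightarrow>
     (\<forall>\<gamma> \<in> deck_transformations C p. h \<gamma> \<in> affine_transformations \<and>
        (\<forall>x \<in> topspace C. D (\<gamma> x) = h \<gamma> (D x)))"

definition holonomy_invariant_subspace ::
  "'b topology \<Rightarrow> ('b \<Rightarrow> 'a) \<Rightarrow> (('b \<Rightarrow> 'b) \<Rightarrow> real^'n \<Rightarrow> real^'n::finite) \<Rightarrow> (real^'n) set \<Rightarrow> bool" where
  "holonomy_invariant_subspace C p h U \<longleftrightarrow>
     subspace U \<and> (\<forall>\<gamma> \<in> deck_transformations C p. linear_part (h \<gamma>) ` U = U)"

text \<open>
  The linear foliation of the base determined by \<open>U\<close>, presented by its leaf topology.
  On the universal cover the leaf topology of the pulled-back foliation is generated by the
  sets \<open>W \<inter> D -` (a + U)\<close> with \<open>W\<close> open; the leaf topology of the base is generated by their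
  images under the covering projection \<open>p\<close>, which is a local homeomorphism for the two
  leaf topologies.  The leaves are the path components for this topology, and each of them
  carries the topology induced by it (its topology as an immersed submanifold), which
  is in general finer than the subspace topology of the base.
\<close>

definition leaf_topology ::
  "'b topology \<Rightarrow> ('b \<Rightarrow> 'a) \<Rightarrow> ('b \<Rightarrow> real^'n::finite) \<Rightarrow> (real^'n) set \<Rightarrow> 'a topology" where
  "leaf_topology C p D U =
     topology_generated_by {p ` (W \<inter> D -` ((+) a ` U)) | W a. openin C W}"

definition leaves ::
  "'b topology \<Rightarrow> ('b \<Rightarrow> 'a) \<Rightarrow> ('b \<Rightarrow> real^'n::finite) \<Rightarrow> (real^'n) set \<Rightarrow> 'a set set" where
  "leaves C p D U = path_components_of (leaf_topology C p D U)"

definition leaf_space ::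
  "'b topology \<Rightarrow> ('b \<Rightarrow> 'a) \<Rightarrow> ('b \<Rightarrow> real^'n::finite) \<Rightarrow> (real^'n) set \<Rightarrow> 'a set \<Rightarrow> 'a topology" where
  "leaf_space C p D U F = subtopology (leaf_topology C p D U) F"


section \<open>The torus\<close>

definition torus :: "('n \<Rightarrow> complex) topology" where
  "torus = product_topology (\<lambda>_. top_of_set (sphere 0 1)) UNIV"

end

theory Submission
  imports Defs
begin

text \<open>
  Completeness makes the developing map a homeomorphism, so \<open>M\<close> is the quotient of \<open>\<real>\<^sup>n\<close> by a
  group \<open>\<Gamma>\<close> of affine maps acting freely, properly and cocompactly.  An element of \<open>\<Gamma>\<close> that
  preserves a hyperplane \<open>a + U\<close> closes up a segment to a loop in a leaf; as that leaf is simply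
  connected, the element is trivial.  Hence \<open>\<Gamma>\<close> acts freely on \<open>\<real>\<^sup>n / U\<close>, a line, by affine maps;
  these are translations, and \<open>\<Gamma>\<close> is abelian.

  For abelian \<open>\<Gamma>\<close>, cocompactness and properness force all linear parts to be unipotent, and
  cocompactness forces the displacements \<open>T x - x\<close> to span \<open>\<real>\<^sup>n\<close>.  So the logarithms of \<open>\<Gamma>\<close> span an
  abelian Lie algebra whose exponential acts simply transitively on \<open>\<real>\<^sup>n\<close>.  The orbit map conjugates
  \<open>\<Gamma>\<close> to a discrete cocompact group of translations, which is a lattice.
\<close>

section \<open>Lifting along coverings and local homeomorphisms\<close>

text \<open>The group that acts simply transitively only has to commute with
  \<open>\<Gamma>\<close>; it need not be shown to contain it. This is why the nilpotent maps
  \<open>T - 1\<close> on the linearised space can stand in for logarithms: finitely many of them,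
  with displacements of the origin forming a basis, span an abelian Lie algebra whose exponential is
  a finite sum and commutes with every \<open>T\<close>. If \<open>\<psi> x\<close> is the
  exponential of \<open>x\<close> applied to the origin and \<open>T 0 = \<psi> l\<close>, then
  commuting alone gives \<open>T (\<psi> x) = \<psi> (x + l)\<close>. The map \<open>\<psi>\<close>
  is polynomial and in general not affine, so the result is a homeomorphism and not an affine
  equivalence. The displacements have to span at every point, not just at the origin: this is what
  makes the exponential act freely everywhere, and freeness together with invariance of domain makes
  the orbits open.\<close>

definition local_homeomorphism :: "'b topology \<Rightarrow> 'a topology \<Rightarrow> ('b \<Rightarrow> 'a) \<Rightarrow> bool" where
  "local_homeomorphism Y X q \<longleftrightarrow> continuous_map Y X q \<and> open_map Y X q \<and>
     (\<forall>y \<in> topspace Y. \<exists>W. openin Y W \<and> y \<in> W \<and> inj_on q W)"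

lemma continuous_map_local_inverse:
  assumes q: "local_homeomorphism Y X q" and W: "openin Y W" and inj: "inj_on q W"
  shows "openin X (q ` W)" "continuous_map (subtopology X (q ` W)) Y (inv_into W q)"
proof -
  show o: "openin X (q ` W)"
    using q W unfolding local_homeomorphism_def open_map_def by blast
  have WY: "W \<subseteq> topspace Y" using W by (rule openin_subset)
  show "continuous_map (subtopology X (q ` W)) Y (inv_into W q)"
    unfolding continuous_map
  proof (intro conjI allI impI)
    have "topspace (subtopology X (q ` W)) = q ` W"
      using openin_subset[OF o] by auto
    then show "inv_into W q ` topspace (subtopology X (q ` W)) \<subseteq> topspace Y"
      using WY inv_into_into[of _ q W] by blast
    fix O' assume O: "openin Y O'"
    have "{x \<in> topspace (subtopology X (q ` W)). inv_into W q x \<in> O'} = q ` (W \<inter> O')"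
      using openin_subset[OF o] inj by (auto simp: inv_into_f_f)
    moreover have "openin X (q ` (W \<inter> O'))"
      using q W O unfolding local_homeomorphism_def open_map_def by blast
    ultimately show "openin (subtopology X (q ` W)) {x \<in> topspace (subtopology X (q ` W)). inv_into W q x \<in> O'}"
      using o by (metis (no_types, lifting) Int_lower1 image_mono openin_open_subtopology)
  qed
qed

text \<open>The set of agreement is closed because \<open>Y\<close> is Hausdorff and open because
  \<open>q\<close> is locally injective. No covering property is involved, so the lemma also serves
  for the developing map before it is known to be bijective.\<close>

lemma unique_lift:
  assumes Z: "connected_space Z" and Y: "Hausdorff_space Y"
    and inj: "\<And>y. y \<in> topspace Y \<Longrightarrow> \<exists>W. openin Y W \<and> y \<in> W \<and> inj_on q W"
    and f: "continuous_map Z Y f" and g: "continuous_map Z Y g"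
    and eq: "\<And>z. z \<in> topspace Z \<Longrightarrow> q (f z) = q (g z)"
    and z0: "z0 \<in> topspace Z" "f z0 = g z0" and z: "z \<in> topspace Z"
  shows "f z = g z"
proof -
  define S where "S = {z \<in> topspace Z. f z = g z}"
  have "closedin Z S"
    unfolding S_def by (rule closedin_continuous_maps_eq[OF Y f g])
  moreover have "openin Z S"
  proof (subst openin_subopen, intro ballI)
    fix x assume x: "x \<in> S"
    then have "f x \<in> topspace Y" using f S_def continuous_map_image_subset_topspace by fastforce
    then obtain W where W: "openin Y W" "f x \<in> W" "inj_on q W" using inj by blast
    define T where "T = {z \<in> topspace Z. f z \<in> W} \<inter> {z \<in> topspace Z. g z \<in> W}"
    have "openin Z T"
      unfolding T_def using W f g by (intro openin_Int openin_continuous_map_preimage) auto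
    moreover have "x \<in> T" using x W by (auto simp: S_def T_def)
    moreover have "T \<subseteq> S" using W eq by (auto simp: S_def T_def inj_on_def)
    ultimately show "\<exists>T. openin Z T \<and> x \<in> T \<and> T \<subseteq> S" by blast
  qed
  ultimately have "S = {} \<or> S = topspace Z"
    using Z by (simp add: connected_space_clopen_in)
  then show ?thesis using z z0 by (auto simp: S_def)
qed

text \<open>The lifts \<open>G z\<close> are chosen separately for each \<open>z\<close>, with no
  joint continuity given. Continuity at a parameter travels along the path: over a short time
  interval \<open>G z0\<close> stays in one sheet, and uniqueness of lifts keeps the neighbouring
  paths in that sheet. It is used for the developing map, lifting segments, and for the covering,
  lifting a homotopy.\<close>

lemma end_of_lift_continuous:
  fixes G :: "'z \<Rightarrow> real \<Rightarrow> 'b"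
  assumes q: "local_homeomorphism Y X q" and Y: "Hausdorff_space Y"
    and H: "continuous_map (prod_topology Z (top_of_set {0..1})) X (\<lambda>(z, t). q (G z t))"
    and G: "\<And>z. z \<in> topspace Z \<Longrightarrow> continuous_map (top_of_set {0..1}) Y (G z)"
    and G0: "continuous_map Z Y (\<lambda>z. G z 0)"
  shows "continuous_map Z Y (\<lambda>z. G z 1)"
proof -
  \<comment> \<open>\<open>cnt z0 a\<close> is continuity of \<open>\<lambda>z. G z a\<close> at the
    single point \<open>z0\<close>; this pointwise property is what is carried from time
    \<open>a\<close> to time \<open>b\<close>.\<close>
  define cnt where "cnt z0 a \<longleftrightarrow>
    (\<forall>W. openin Y W \<and> G z0 a \<in> W \<longrightarrow> (\<exists>A. openin Z A \<and> z0 \<in> A \<and> (\<forall>z \<in> A. G z a \<in> W)))" for z0 a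
  have step: "cnt z0 1" if z0: "z0 \<in> topspace Z" for z0
  proof -
    define P where "P a b \<longleftrightarrow> (0 \<le> a \<and> a \<le> b \<and> b \<le> 1 \<longrightarrow> cnt z0 a \<longrightarrow> cnt z0 b)" for a b
    have "P 0 1"
    proof (rule Bolzano)
      show "(0::real) \<le> 1" by simp
      show "P a c" if "P a b" "P b c" "a \<le> b" "b \<le> c" for a b c
        using that unfolding P_def by auto
    next
      fix t :: real assume t: "0 \<le> t" "t \<le> 1"
      have "G z0 t \<in> topspace Y"
        using G[OF z0] t continuous_map_image_subset_topspace by fastforce
      then obtain W where W: "openin Y W" "G z0 t \<in> W" "inj_on q W"
        using q unfolding local_homeomorphism_def by blast
      note inv = continuous_map_local_inverse[OF q W(1,3)]
      have o: "openin (prod_topology Z (top_of_set {0..1}))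
          {zt \<in> topspace (prod_topology Z (top_of_set {0..1})). (\<lambda>(z, t). q (G z t)) zt \<in> q ` W}"
        by (rule openin_continuous_map_preimage[OF H inv(1)])
      have m: "(z0, t) \<in> {zt \<in> topspace (prod_topology Z (top_of_set {0..1})). (\<lambda>(z, t). q (G z t)) zt \<in> q ` W}"
        using z0 t W by auto
      \<comment> \<open>A box around \<open>(z0, t)\<close> on which all projected paths stay in the
        image of the one sheet \<open>W\<close>.\<close>
      from openin_prod_topology_alt[THEN iffD1, OF o, rule_format, OF m] obtain A1 B1 where A1: "openin Z A1" "openin (top_of_set {0..1}) B1" "z0 \<in> A1" "t \<in> B1"
        "A1 \<times> B1 \<subseteq> {zt \<in> topspace (prod_topology Z (top_of_set {0..1})). (\<lambda>(z, t). q (G z t)) zt \<in> q ` W}"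
        by (elim exE conjE)
      have "openin (top_of_set {0..1}) {s \<in> topspace (top_of_set {0..1}). G z0 s \<in> W}"
        by (rule openin_continuous_map_preimage[OF G[OF z0] W(1)])
      then have "openin (top_of_set {0..1}) (B1 \<inter> {s \<in> topspace (top_of_set {0..1}). G z0 s \<in> W})"
        using A1 by blast
      moreover have "t \<in> B1 \<inter> {s \<in> topspace (top_of_set {0..1}). G z0 s \<in> W}"
        using A1 t W by auto
      ultimately obtain d where d: "d > 0"
        "\<And>s. s \<in> {0..1} \<Longrightarrow> \<bar>s - t\<bar> < d \<Longrightarrow> s \<in> B1 \<and> G z0 s \<in> W"
        unfolding openin_euclidean_subtopology_iff dist_real_def by blast
      show "\<exists>d>0. \<forall>a b. a \<le> t \<and> t \<le> b \<and> b - a < d \<longrightarrow> P a b"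
      proof (intro exI[of _ d] conjI allI impI d(1))
        fix a b assume ab: "a \<le> t \<and> t \<le> b \<and> b - a < d"
        show "P a b" unfolding P_def
        proof (intro impI, elim conjE)
          assume ab': "0 \<le> a" "a \<le> b" "b \<le> 1" and c: "cnt z0 a"
          have near: "s \<in> B1 \<and> G z0 s \<in> W" if "s \<in> {a..b}" for s
            using d(2)[of s] ab ab' that by auto
          obtain A2 where A2: "openin Z A2" "z0 \<in> A2" "\<And>z. z \<in> A2 \<Longrightarrow> G z a \<in> W"
            using c near[of a] ab' W(1) unfolding cnt_def by (meson atLeastAtMost_iff order_refl)
          have in_W: "G z s \<in> W" if z: "z \<in> A1 \<inter> A2" and s: "s \<in> {a..b}" for z s
          proof -
            have zZ: "z \<in> topspace Z" using z A1 openin_subset by blast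
            have sub: "{a..b} \<subseteq> {0..1}" using ab' by auto
            have qW: "q (G z s) \<in> q ` W" if "s \<in> {a..b}" for s
              using A1(5) z near[OF that] by auto
            have Gz: "continuous_map (top_of_set {a..b}) Y (G z)"
              using G[OF zZ] sub by (metis continuous_map_from_subtopology_mono)
            have "continuous_map (top_of_set {a..b}) X (\<lambda>s. q (G z s))"
              using continuous_map_compose[OF Gz, of X q] q unfolding local_homeomorphism_def o_def by blast
            then have "continuous_map (top_of_set {a..b}) (subtopology X (q ` W)) (\<lambda>s. q (G z s))"
              using qW by (auto simp: continuous_map_in_subtopology)
            from continuous_map_compose[OF this inv(2)]
            have kc: "continuous_map (top_of_set {a..b}) Y (\<lambda>s. inv_into W q (q (G z s)))"
              by (simp add: o_def)
            \<comment> \<open>\<open>G z\<close> and the local inverse applied to its projection are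
              two lifts on \<open>{a..b}\<close> that agree at \<open>a\<close>, so
              \<open>G z\<close> does not leave the sheet \<open>W\<close>.\<close>
            have "G z s = inv_into W q (q (G z s))"
            proof (rule unique_lift[OF _ Y _ Gz kc, where q = q and ?z0.0 = a])
              show "connected_space (top_of_set {a..b})" by (simp add: connected_space_subtopology connectedin_subtopology flip: connectedin_topspace)
              show "\<exists>W. openin Y W \<and> y \<in> W \<and> inj_on q W" if "y \<in> topspace Y" for y
                using q that unfolding local_homeomorphism_def by blast
              show "q (G z s) = q (inv_into W q (q (G z s)))" if "s \<in> topspace (top_of_set {a..b})" for s
                using qW[of s] that by (simp add: f_inv_into_f)
              show "G z a = inv_into W q (q (G z a))"
                using A2(3) z W(3) by (simp add: inv_into_f_f)
            qed (use ab' s in auto)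
            then show ?thesis using qW[OF s] by (metis inv_into_into)
          qed
          show "cnt z0 b" unfolding cnt_def
          proof (intro allI impI, elim conjE)
            \<comment> \<open>A smaller neighbourhood \<open>W'\<close> is controlled through the
              projection: a point of \<open>W\<close> whose image lies in the image of
              \<open>W \<inter> W'\<close> is in \<open>W'\<close>, since \<open>q\<close> is
              injective on \<open>W\<close>.\<close>
            fix W' assume W': "openin Y W'" "G z0 b \<in> W'"
            have WW: "openin Y (W \<inter> W')" using W W' by blast
            have oq: "openin X (q ` (W \<inter> W'))"
              using q WW unfolding local_homeomorphism_def open_map_def by blast
            have "b \<in> {0..1}" using ab' by auto
            then have "continuous_map Z (prod_topology Z (top_of_set {0..1})) (\<lambda>z. (z, b))"
              by (intro continuous_map_pairedI) auto
            from continuous_map_compose[OF this H]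
            have "continuous_map Z X (\<lambda>z. q (G z b))" by (simp add: o_def)
            from openin_continuous_map_preimage[OF this oq]
            have A3: "openin Z {z \<in> topspace Z. q (G z b) \<in> q ` (W \<inter> W')}" .
            show "\<exists>A. openin Z A \<and> z0 \<in> A \<and> (\<forall>z\<in>A. G z b \<in> W')"
            proof (intro exI conjI ballI)
              show "openin Z (A1 \<inter> A2 \<inter> {z \<in> topspace Z. q (G z b) \<in> q ` (W \<inter> W')})"
                using A1 A2 A3 by blast
              show "z0 \<in> A1 \<inter> A2 \<inter> {z \<in> topspace Z. q (G z b) \<in> q ` (W \<inter> W')}"
                using A1 A2 z0 near[of b] ab' W' by auto
              fix z assume z: "z \<in> A1 \<inter> A2 \<inter> {z \<in> topspace Z. q (G z b) \<in> q ` (W \<inter> W')}"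
              then obtain y where "y \<in> W \<inter> W'" "q (G z b) = q y" by auto
              moreover have "G z b \<in> W" using in_W[of z b] z ab' by auto
              ultimately show "G z b \<in> W'" using W(3) by (auto simp: inj_on_def)
            qed
          qed
        qed
      qed
    qed
    moreover have "cnt z0 0" unfolding cnt_def
    proof (intro allI impI)
      fix W assume "openin Y W \<and> G z0 0 \<in> W"
      then show "\<exists>A. openin Z A \<and> z0 \<in> A \<and> (\<forall>z\<in>A. G z 0 \<in> W)"
        using openin_continuous_map_preimage[OF G0, of W] z0
        by (intro exI[of _ "{z \<in> topspace Z. G z 0 \<in> W}"]) auto
    qed
    ultimately show ?thesis by (simp add: P_def)
  qed
  show ?thesis
    unfolding continuous_map
  proof (intro conjI allI impI)
    show "(\<lambda>z. G z 1) ` topspace Z \<subseteq> topspace Y"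
      using G continuous_map_image_subset_topspace by fastforce
    fix W assume W: "openin Y W"
    show "openin Z {z \<in> topspace Z. G z 1 \<in> W}"
    proof (subst openin_subopen, intro ballI)
      fix z0 assume "z0 \<in> {z \<in> topspace Z. G z 1 \<in> W}"
      then obtain A where "openin Z A" "z0 \<in> A" "\<forall>z \<in> A. G z 1 \<in> W"
        using step[of z0] W unfolding cnt_def by blast
      then show "\<exists>T. openin Z T \<and> z0 \<in> T \<and> T \<subseteq> {z \<in> topspace Z. G z 1 \<in> W}"
        using openin_subset by (intro exI[of _ A]) auto
    qed
  qed
qed

section \<open>Covering maps: path lifting and local structure\<close>

lemma covering_map_evenly_covered:
  assumes C: "covering_map C p X" and x: "x \<in> topspace X"
  obtains T \<V> where "x \<in> T" "openin X T" "\<Union>\<V> = topspace C \<inter> p -` T"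
    "\<And>W. W \<in> \<V> \<Longrightarrow> openin C W" "pairwise disjnt \<V>"
    "\<And>W. W \<in> \<V> \<Longrightarrow> homeomorphic_map (subtopology C W) (subtopology X T) p"
proof -
  have "\<forall>x \<in> topspace X. \<exists>T. x \<in> T \<and> openin X T \<and>
        (\<exists>\<V>. \<Union>\<V> = topspace C \<inter> p -` T \<and> (\<forall>W \<in> \<V>. openin C W) \<and> pairwise disjnt \<V> \<and>
             (\<forall>W \<in> \<V>. homeomorphic_map (subtopology C W) (subtopology X T) p))"
    using C unfolding covering_map_def by (elim conjE)
  from bspec[OF this x] obtain T \<V> where T: "x \<in> T" "openin X T"
    and V: "\<Union>\<V> = topspace C \<inter> p -` T" "\<forall>W \<in> \<V>. openin C W" "pairwise disjnt \<V>"
      "\<forall>W \<in> \<V>. homeomorphic_map (subtopology C W) (subtopology X T) p"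
    by (elim exE conjE)
  show thesis
    by (rule that[OF T V(1) bspec[OF V(2)] V(3) bspec[OF V(4)]])
qed

text \<open>An interval short enough to be mapped into an evenly covered set lifts by the inverse of
  one sheet. The property \<open>P\<close> quantifies over all starting points in the fibre, so that
  lifts over adjacent intervals can be glued.\<close>

lemma path_lifting:
  assumes C: "covering_map C p X" and c: "continuous_map (top_of_set {0..1::real}) X c"
    and y: "y \<in> topspace C" "p y = c 0"
  shows "\<exists>g. continuous_map (top_of_set {0..1}) C g \<and> g 0 = y \<and> (\<forall>t \<in> {0..1}. p (g t) = c t)"
proof -
  define P where "P a b \<longleftrightarrow> (0 \<le> a \<and> a \<le> b \<and> b \<le> 1 \<longrightarrow> (\<forall>y \<in> topspace C. p y = c a \<longrightarrow>
    (\<exists>g. continuous_map (top_of_set {a..b}) C g \<and> g a = y \<and> (\<forall>t \<in> {a..b}. p (g t) = c t))))" for a b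
  have "P 0 1"
  proof (rule Bolzano)
    show "(0::real) \<le> 1" by simp
    fix a b d assume 1: "P a b" and 2: "P b d" and ord: "a \<le> b" "b \<le> d"
    show "P a d" unfolding P_def
    proof (intro impI ballI)
      fix y assume 0: "0 \<le> a \<and> a \<le> d \<and> d \<le> 1" and y: "y \<in> topspace C" "p y = c a"
      obtain g where g: "continuous_map (top_of_set {a..b}) C g" "g a = y" "\<forall>t \<in> {a..b}. p (g t) = c t"
        using 1 0 ord y unfolding P_def by fastforce
      have "g b \<in> topspace C" using g(1) ord continuous_map_image_subset_topspace by fastforce
      then obtain k where k: "continuous_map (top_of_set {b..d}) C k" "k b = g b" "\<forall>t \<in> {b..d}. p (k t) = c t"
        using 2 0 ord g(3) unfolding P_def by fastforce
      have "continuous_map (top_of_set {a..d}) C (\<lambda>x. if x \<le> b then g x else k x)"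
      proof (rule continuous_map_cases_le)
        show "continuous_map (top_of_set {a..d}) euclideanreal (\<lambda>x. x)" by simp
        show "continuous_map (top_of_set {a..d}) euclideanreal (\<lambda>x. b)" by simp
        have "{a..d} \<inter> {x \<in> topspace (top_of_set {a..d}). x \<le> b} = {a..b}" using ord by auto
        then show "continuous_map (subtopology (top_of_set {a..d}) {x \<in> topspace (top_of_set {a..d}). x \<le> b}) C g"
          using g(1) by (simp add: subtopology_subtopology)
        have "{a..d} \<inter> {x \<in> topspace (top_of_set {a..d}). b \<le> x} = {b..d}" using ord by auto
        then show "continuous_map (subtopology (top_of_set {a..d}) {x \<in> topspace (top_of_set {a..d}). b \<le> x}) C k"
          using k(1) by (simp add: subtopology_subtopology)
        show "g x = k x" if "x = b" for x using that k by simp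
      qed
      then show "\<exists>g. continuous_map (top_of_set {a..d}) C g \<and> g a = y \<and> (\<forall>t \<in> {a..d}. p (g t) = c t)"
        using g k ord by (intro exI[of _ "\<lambda>x. if x \<le> b then g x else k x"]) auto
    qed
  next
    fix t :: real assume t: "0 \<le> t" "t \<le> 1"
    then have "c t \<in> topspace X" using c continuous_map_image_subset_topspace by fastforce
    then obtain T \<V> where T: "c t \<in> T" "openin X T" and V: "\<Union>\<V> = topspace C \<inter> p -` T"
      "\<And>W. W \<in> \<V> \<Longrightarrow> homeomorphic_map (subtopology C W) (subtopology X T) p" 
      using covering_map_evenly_covered[OF C] by metis
    have "openin (top_of_set {0..1}) {s \<in> topspace (top_of_set {0..1}). c s \<in> T}"
      by (rule openin_continuous_map_preimage[OF c T(2)])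
    moreover have "t \<in> {s \<in> topspace (top_of_set {0..1}). c s \<in> T}" using t T by auto
    ultimately obtain d where d: "d > 0" "\<And>s. s \<in> {0..1} \<Longrightarrow> \<bar>s - t\<bar> < d \<Longrightarrow> c s \<in> T"
      unfolding openin_euclidean_subtopology_iff dist_real_def by blast
    show "\<exists>d>0. \<forall>a b. a \<le> t \<and> t \<le> b \<and> b - a < d \<longrightarrow> P a b"
    proof (intro exI[of _ d] conjI allI impI d(1))
      fix a b assume ab: "a \<le> t \<and> t \<le> b \<and> b - a < d"
      show "P a b" unfolding P_def
      proof (intro impI ballI)
        fix y assume ab': "0 \<le> a \<and> a \<le> b \<and> b \<le> 1" and y: "y \<in> topspace C" "p y = c a"
        have cT: "c s \<in> T" if "s \<in> {a..b}" for s
          using d(2)[of s] ab ab' that by auto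
        then have "y \<in> \<Union>\<V>" using V(1) y ab' by auto
        then obtain W where W: "W \<in> \<V>" "y \<in> W" by blast
        obtain k where k: "homeomorphic_maps (subtopology C W) (subtopology X T) p k"
          using V(2) W homeomorphic_map_maps by blast
        have "continuous_map (top_of_set {a..b}) X c"
          using c ab' by (metis continuous_map_from_subtopology_mono atLeastatMost_subset_iff)
        then have "continuous_map (top_of_set {a..b}) (subtopology X T) c"
          using cT by (auto simp: continuous_map_in_subtopology)
        moreover have "continuous_map (subtopology X T) C k"
          using k unfolding homeomorphic_maps_def continuous_map_in_subtopology by blast
        ultimately have "continuous_map (top_of_set {a..b}) C (k \<circ> c)" by (rule continuous_map_compose)
        moreover have "(k \<circ> c) a = y"
          using k y W unfolding homeomorphic_maps_def by (auto simp flip: y(2))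
        moreover have "p ((k \<circ> c) s) = c s" if "s \<in> {a..b}" for s
          using k cT[OF that] openin_subset[OF T(2)] unfolding homeomorphic_maps_def by auto
        ultimately show "\<exists>g. continuous_map (top_of_set {a..b}) C g \<and> g a = y \<and> (\<forall>t \<in> {a..b}. p (g t) = c t)"
          by blast
      qed
    qed
  qed
  then show ?thesis using y unfolding P_def by simp
qed

lemma covering_map_imp_local_homeomorphism:
  assumes "covering_map C p X"
  shows "local_homeomorphism C X p"
  unfolding local_homeomorphism_def
proof (intro conjI ballI)
  show "continuous_map C X p" using assms by (simp add: covering_map_def)
  have ex: "\<exists>T W. openin X T \<and> openin C W \<and> y \<in> W \<and> homeomorphic_map (subtopology C W) (subtopology X T) p"
    if y: "y \<in> topspace C" for y
  proof -
    have "p y \<in> topspace X" using assms y by (auto simp: covering_map_def)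
    then obtain T \<V> where T: "p y \<in> T" "openin X T" and V: "\<Union>\<V> = topspace C \<inter> p -` T"
      "\<And>W. W \<in> \<V> \<Longrightarrow> openin C W" "\<And>W. W \<in> \<V> \<Longrightarrow> homeomorphic_map (subtopology C W) (subtopology X T) p" 
      using covering_map_evenly_covered[OF assms] by metis
    then have "y \<in> \<Union>\<V>" using y by simp
    then show ?thesis using T V by blast
  qed
  show "\<exists>W. openin C W \<and> y \<in> W \<and> inj_on p W" if y: "y \<in> topspace C" for y
  proof -
    obtain T W where W: "openin C W" "y \<in> W" "homeomorphic_map (subtopology C W) (subtopology X T) p"
      using ex[OF y] by blast
    then have "inj_on p W"
      using homeomorphic_imp_injective_map[OF W(3)] openin_subset[OF W(1)]
      by (simp add: Int_absorb1)
    then show ?thesis using W by blast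
  qed
  show "open_map C X p" unfolding open_map_def
  proof (intro allI impI)
    fix O' assume O: "openin C O'"
    show "openin X (p ` O')"
    proof (subst openin_subopen, intro ballI)
      fix x assume "x \<in> p ` O'"
      then obtain y where y: "y \<in> O'" "x = p y" by blast
      obtain T W where W: "openin X T" "openin C W" "y \<in> W" "homeomorphic_map (subtopology C W) (subtopology X T) p"
        using ex[of y] y O openin_subset by blast
      have "openin (subtopology C W) (O' \<inter> W)" using O openin_subtopology by blast
      then have "openin (subtopology X T) (p ` (O' \<inter> W))"
        using homeomorphic_imp_open_map[OF W(4)] unfolding open_map_def by blast
      then have "openin X (p ` (O' \<inter> W))" using W(1) openin_trans_full by blast
      then show "\<exists>T. openin X T \<and> x \<in> T \<and> T \<subseteq> p ` O'" using y W by blast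
    qed
  qed
qed

text \<open>Points of different fibres are separated by preimages from the base, points of the same
  fibre by the disjoint sheets over an evenly covered set.\<close>

lemma covering_map_Hausdorff:
  assumes C: "covering_map C p X" and X: "Hausdorff_space X"
  shows "Hausdorff_space C"
  unfolding Hausdorff_space_def
proof (intro allI impI)
  fix x y assume xy: "x \<in> topspace C \<and> y \<in> topspace C \<and> x \<noteq> y"
  have pc: "continuous_map C X p" using C by (simp add: covering_map_def)
  have px: "p x \<in> topspace X" "p y \<in> topspace X" using C xy by (auto simp: covering_map_def)
  show "\<exists>U V. openin C U \<and> openin C V \<and> x \<in> U \<and> y \<in> V \<and> disjnt U V"
  proof (cases "p x = p y")
    case False
    then obtain U V where UV: "openin X U" "openin X V" "p x \<in> U" "p y \<in> V" "disjnt U V"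
      using X px unfolding Hausdorff_space_def by blast
    show ?thesis
    proof (intro exI conjI)
      show "openin C {x \<in> topspace C. p x \<in> U}" "openin C {x \<in> topspace C. p x \<in> V}"
        by (rule openin_continuous_map_preimage[OF pc UV(1)], rule openin_continuous_map_preimage[OF pc UV(2)])
    qed (use xy UV in \<open>auto simp: disjnt_iff\<close>)
  next
    case True
    obtain T \<V> where T: "p x \<in> T" "openin X T" and V: "\<Union>\<V> = topspace C \<inter> p -` T"
      "\<And>W. W \<in> \<V> \<Longrightarrow> openin C W" "pairwise disjnt \<V>"
      "\<And>W. W \<in> \<V> \<Longrightarrow> homeomorphic_map (subtopology C W) (subtopology X T) p" 
      using covering_map_evenly_covered[OF C px(1)] by metis
    have "x \<in> \<Union>\<V>" "y \<in> \<Union>\<V>" using V(1) T xy True by auto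
    then obtain W W' where W: "W \<in> \<V>" "x \<in> W" "W' \<in> \<V>" "y \<in> W'" by blast
    have "inj_on p W"
      using homeomorphic_imp_injective_map V(4) W(1) openin_subset V(2)
      by (metis Int_absorb1 topspace_subtopology)
    then have "W \<noteq> W'" using W True xy by (auto simp: inj_on_def)
    then show ?thesis using W V(2,3) by (meson pairwiseD)
  qed
qed

section \<open>Exponentials of nilpotent linear maps\<close>

lemma linear_funpow:
  fixes A :: "'v::real_vector \<Rightarrow> 'v"
  assumes "linear A" shows "linear (A ^^ k)"
proof (induction k)
  case 0 then show ?case by (simp add: linear_id[unfolded id_def] id_def)
next
  case (Suc k) then show ?case using linear_compose[OF Suc assms] by (simp add: o_def)
qed

lemma funpow_commute:
  assumes "\<And>u. A (B u) = B (A u)"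
  shows "(A ^^ k) (B u) = B ((A ^^ k) u)"
  using assms by (induction k) auto

text \<open>The power \<open>m\<close> minimises the dimension of the range. All later ranges then
  coincide, so the power \<open>N ^^ m\<close> maps its range onto itself and hence, by finite
  dimension, injectively. Minimising only over \<open>m \<ge> 1\<close> leaves a factor
  \<open>N\<close> in the power, which \<open>unipotent\<close> relies on.\<close>

lemma linear_fitting:
  fixes N :: "'v::euclidean_space \<Rightarrow> 'v"
  assumes N: "linear N"
  obtains m where "m \<ge> 1" "range (N ^^ m) = N ` range (N ^^ m)" "range (N ^^ m) = (N ^^ m) ` range (N ^^ m)"
    "\<And>x. (N ^^ m) ((N ^^ m) x) = 0 \<Longrightarrow> (N ^^ m) x = 0"
proof -
  define d where "d k = dim (range (N ^^ k))" for k
  obtain m where m: "m \<ge> 1" and min: "\<And>k. k \<ge> 1 \<Longrightarrow> d m \<le> d k"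
    using ex_has_least_nat[of "\<lambda>m. m \<ge> (1::nat)" 1 d] by blast
  define R where "R = N ^^ m"
  have R: "linear R" unfolding R_def by (rule linear_funpow[OF N])
  have eq: "range (N ^^ (m + k)) = range R" for k
  proof (rule subspace_dim_equal)
    show "subspace (range (N ^^ (m + k)))" "subspace (range R)"
      unfolding R_def by (simp_all add: linear_subspace_image linear_funpow[OF N])
    show "range (N ^^ (m + k)) \<subseteq> range R" by (auto simp: R_def funpow_add)
    show "dim (range (N ^^ (m + k))) \<ge> dim (range R)"
      using min[of "m + k"] m by (simp add: d_def R_def)
  qed
  have 1: "range R = N ` range R"
    using eq[of 1] by (simp add: R_def image_image o_def)
  have 2: "range R = R ` range R"
    using eq[of m] by (simp add: R_def image_image funpow_add o_def)
  obtain B where B: "finite B" "B \<subseteq> range R" "independent B" "span B = range R" "card B = dim (range R)"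
    using basis_subspace_exists[of "range R"] R by (metis linear_subspace_image subspace_UNIV)
  have sp: "span (R ` B) = range R"
    using linear_span_image[OF R, of B] B 2 by simp
  have "card (R ` B) \<ge> dim (range R)"
    using sp B(1) by (metis dim_le_card dim_span finite_imageI order_refl)
  then have c: "card (R ` B) = card B"
    using B(5) card_image_le[OF B(1), of R] by simp
  then have inj: "inj_on R B" using B(1) by (rule eq_card_imp_inj_on[rotated])
  have "independent (R ` B)"
    using sp B(1,5) c by (metis card_le_dim_spanning dim_span finite_imageI order_refl span_superset sp)
  then have inj: "inj_on R (range R)"
    using linear_inj_on_span_independent_image[OF R _ inj] B(4) by simp
  show thesis
  proof (rule that[of m])
    fix x assume "(N ^^ m) ((N ^^ m) x) = 0"
    then have "R (R x) = R (R 0)" using linear_0[OF R] by (simp add: R_def)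
    then have "R x = R 0" using inj by (auto simp: inj_on_def)
    then show "(N ^^ m) x = 0" using linear_0[OF R] by (simp add: R_def)
  qed (use m 1 2 in \<open>auto simp: R_def\<close>)
qed

text \<open>The exponential series cut off after \<open>M\<close> terms; it is the full exponential
  as soon as \<open>A ^^ M\<close> vanishes. Working with a finite sum avoids convergence and makes
  commutation and continuity termwise.\<close>

definition texp :: "nat \<Rightarrow> ('v::real_vector \<Rightarrow> 'v) \<Rightarrow> 'v \<Rightarrow> 'v" where
  "texp M A u = (\<Sum>k<M. (A ^^ k) u /\<^sub>R fact k)"

lemma texp_linear:
  assumes "linear A" shows "linear (texp M A)"
  unfolding texp_def[abs_def]
  by (intro linear_compose_sum ballI linear_compose_scale_right linear_funpow assms)

lemma texp_commute:
  assumes "linear B" "\<And>u. A (B u) = B (A u)"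
  shows "texp M A (B u) = B (texp M A u)"
  unfolding texp_def
  by (simp add: linear_sum[OF assms(1)] linear_scale[OF assms(1)] funpow_commute[of A B, OF assms(2)])

text \<open>The binomial theorem in divided powers. Applying \<open>A\<close> or \<open>B\<close> to
  \<open>t i j\<close> raises one index at the price of the factor \<open>i + 1\<close> or
  \<open>j + 1\<close>, and in degree \<open>n + 1\<close> the two factors of each term add up to
  \<open>n + 1\<close>.\<close>

lemma funpow_add_commuting:
  fixes A B :: "'v::real_vector \<Rightarrow> 'v"
  assumes A: "linear A" and B: "linear B" and AB: "\<And>u. A (B u) = B (A u)"
  shows "((\<lambda>u. A u + B u) ^^ n) u /\<^sub>R fact n
    = (\<Sum>i\<le>n. (A ^^ i) ((B ^^ (n - i)) u) /\<^sub>R (fact i * fact (n - i)))"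
proof (induction n)
  case (Suc n)
  define t where "t i j = (A ^^ i) ((B ^^ j) u) /\<^sub>R (fact i * fact j)" for i j
  have Ai: "linear (A ^^ i)" for i by (rule linear_funpow[OF A])
  have tA: "A (t i j) = real (Suc i) *\<^sub>R t (Suc i) j" for i j
    by (simp add: t_def linear_scale[OF A] field_simps del: of_nat_Suc)
  have BAi: "B ((A ^^ i) w) = (A ^^ i) (B w)" for i w
    using funpow_commute[of A B, OF AB] by simp
  have tB: "B (t i j) = real (Suc j) *\<^sub>R t i (Suc j)" for i j
    by (simp add: t_def linear_scale[OF B] BAi field_simps del: of_nat_Suc)
  have "((\<lambda>u. A u + B u) ^^ Suc n) u /\<^sub>R fact n =
      A (((\<lambda>u. A u + B u) ^^ n) u /\<^sub>R fact n) + B (((\<lambda>u. A u + B u) ^^ n) u /\<^sub>R fact n)"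
    by (simp add: linear_scale[OF A] linear_scale[OF B] scaleR_add_right)
  also have "\<dots> = (\<Sum>i\<le>n. A (t i (n - i))) + (\<Sum>i\<le>n. B (t i (n - i)))"
    unfolding Suc.IH t_def by (simp add: linear_sum[OF A] linear_sum[OF B])
  also have "(\<Sum>i\<le>n. A (t i (n - i))) = (\<Sum>i\<le>n. real (Suc i) *\<^sub>R t (Suc i) (n - i))"
    by (simp add: tA)
  also have "\<dots> = (\<Sum>i\<le>Suc n. real i *\<^sub>R t i (Suc n - i))"
    by (subst sum.atMost_Suc_shift) simp
  also have "(\<Sum>i\<le>n. B (t i (n - i))) = (\<Sum>i\<le>n. real (Suc n - i) *\<^sub>R t i (Suc n - i))"
    by (intro sum.cong refl) (simp add: tB Suc_diff_le)
  also have "\<dots> = (\<Sum>i\<le>Suc n. real (Suc n - i) *\<^sub>R t i (Suc n - i))"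
    by simp
  also have "(\<Sum>i\<le>Suc n. real i *\<^sub>R t i (Suc n - i)) + (\<Sum>i\<le>Suc n. real (Suc n - i) *\<^sub>R t i (Suc n - i))
      = (\<Sum>i\<le>Suc n. real (Suc n) *\<^sub>R t i (Suc n - i))"
    unfolding sum.distrib[symmetric] scaleR_add_left[symmetric]
    by (intro sum.cong refl) (metis atMost_iff le_add_diff_inverse of_nat_add)
  finally have "((\<lambda>u. A u + B u) ^^ Suc n) u /\<^sub>R fact n = real (Suc n) *\<^sub>R (\<Sum>i\<le>Suc n. t i (Suc n - i))"
    by (simp only: scaleR_sum_right)
  then have "(((\<lambda>u. A u + B u) ^^ Suc n) u /\<^sub>R fact n) /\<^sub>R real (Suc n) = (\<Sum>i\<le>Suc n. t i (Suc n - i))"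
    by simp
  then show ?case by (simp add: t_def mult.commute)
qed simp

lemma nilpotent_add:
  fixes A B :: "'v::real_vector \<Rightarrow> 'v"
  assumes A: "linear A" and B: "linear B" and AB: "\<And>u. A (B u) = B (A u)"
    and nA: "\<And>u. (A ^^ a) u = 0" and nB: "\<And>u. (B ^^ b) u = 0"
  shows "((\<lambda>u. A u + B u) ^^ (a + b)) u = 0"
proof -
  have z: "(A ^^ i) 0 = 0" "(B ^^ i) 0 = 0" for i
    using linear_0[OF linear_funpow[OF A]] linear_0[OF linear_funpow[OF B]] by auto
  have "(A ^^ i) ((B ^^ (a + b - i)) u) = 0" if "i \<le> a + b" for i
  proof (cases "i \<ge> a")
    case True
    then have "i = (i - a) + a" by simp
    then show ?thesis by (metis funpow_add o_apply nA z(1))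
  next
    case False
    then have "a + b - i = (a - i) + b" by simp
    then show ?thesis by (simp add: funpow_add nB z)
  qed
  then have "((\<lambda>u. A u + B u) ^^ (a + b)) u /\<^sub>R fact (a + b) = 0"
    unfolding funpow_add_commuting[OF A B AB] by simp
  then show ?thesis by simp
qed

text \<open>The product of two truncated series is a sum over a square, the truncated series of the
  sum is one over a triangle. With \<open>2 * K \<le> M\<close> every term outside the triangle has
  an index at least \<open>K\<close> and vanishes.\<close>

lemma texp_add:
  fixes A B :: "'v::real_vector \<Rightarrow> 'v"
  assumes A: "linear A" and B: "linear B" and AB: "\<And>u. A (B u) = B (A u)"
    and nA: "\<And>u. (A ^^ K) u = 0" and nB: "\<And>u. (B ^^ K) u = 0" and M: "2 * K \<le> M"
  shows "texp M (\<lambda>u. A u + B u) u = texp M A (texp M B u)"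
proof -
  define t where "t i j = (A ^^ i) ((B ^^ j) u) /\<^sub>R (fact i * fact j)" for i j
  have z: "(A ^^ i) 0 = 0" "(B ^^ i) 0 = 0" for i
    using linear_0[OF linear_funpow[OF A]] linear_0[OF linear_funpow[OF B]] by auto
  have t0: "t i j = 0" if "i + j \<ge> M" for i j
  proof (cases "i \<ge> K")
    case True
    then have "i = (i - K) + K" by simp
    then have "(A ^^ i) w = 0" for w by (metis funpow_add o_apply nA z(1))
    then show ?thesis by (simp add: t_def)
  next
    case False
    then have "j = (j - K) + K" using that M by simp
    then have "(B ^^ j) u = 0" by (metis funpow_add o_apply nB z(2))
    then show ?thesis by (simp add: t_def z)
  qed
  have tn: "t i j \<noteq> 0 \<Longrightarrow> i + j < M" for i j using t0[of i j] by linarith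
  have "texp M A (texp M B u) = (\<Sum>i<M. \<Sum>j<M. t i j)"
    unfolding texp_def t_def
    by (simp add: linear_sum[OF linear_funpow[OF A]] linear_scale[OF linear_funpow[OF A]] scaleR_sum_right)
  also have "\<dots> = (\<Sum>(i,j)\<in>{..<M}\<times>{..<M}. t i j)" by (simp add: sum.cartesian_product)
  also have "\<dots> = (\<Sum>(i,j)\<in>{(i,j). i + j < M}. t i j)"
    by (rule sum.mono_neutral_right) (auto dest: tn)
  also have "\<dots> = (\<Sum>k<M. \<Sum>i\<le>k. t i (k - i))" by (rule sum.triangle_reindex)
  also have "\<dots> = texp M (\<lambda>u. A u + B u) u"
    unfolding texp_def t_def funpow_add_commuting[OF A B AB] ..
  finally show ?thesis by simp
qed

text \<open>If \<open>A u\<close> were nonzero, the least \<open>m\<close> with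
  \<open>(A ^^ m) u = 0\<close> would be at least 2. Applying \<open>A ^^ (m - 2)\<close> to the
  terms of the series after \<open>u\<close> leaves only \<open>(A ^^ (m - 1)) u\<close>, which
  would then be zero. The bound \<open>M \<ge> 2\<close> keeps the linear term in the sum.\<close>

lemma texp_fixed:
  fixes A :: "'v::real_vector \<Rightarrow> 'v"
  assumes A: "linear A" and nA: "(A ^^ K) u = 0" and M: "M \<ge> 2" and fixed: "texp M A u = u"
  shows "A u = 0"
proof (rule ccontr)
  assume Au: "A u \<noteq> 0"
  define m where "m = (LEAST m. (A ^^ m) u = 0)"
  have m: "(A ^^ m) u = 0" unfolding m_def by (rule LeastI[of "\<lambda>m. (A ^^ m) u = 0", OF nA])
  have least: "(A ^^ k) u \<noteq> 0" if "k < m" for k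
    using that not_less_Least unfolding m_def by blast
  have "m \<noteq> 0" "m \<noteq> 1" using m Au linear_0[OF A] by (auto intro: ccontr)
  then obtain q where q: "m = q + 2" by (metis One_nat_def Suc_1 add_2_eq_Suc' not0_implies_Suc)
  have Aq: "linear (A ^^ k)" for k by (rule linear_funpow[OF A])
  obtain M' where M': "M = Suc (Suc M')" using M by (metis Suc_1 add_2_eq_Suc le_Suc_ex)
  have "texp M A u = u + (A u + (\<Sum>k<M'. (A ^^ Suc (Suc k)) u /\<^sub>R fact (Suc (Suc k))))"
    unfolding texp_def M' by (simp add: sum.lessThan_Suc_shift del: sum.lessThan_Suc)
  then have "A u + (\<Sum>k<M'. (A ^^ Suc (Suc k)) u /\<^sub>R fact (Suc (Suc k))) = 0"
    using fixed by simp
  then have "(A ^^ q) (A u) + (\<Sum>k<M'. (A ^^ q) ((A ^^ Suc (Suc k)) u) /\<^sub>R fact (Suc (Suc k))) = 0"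
    using linear_0[OF Aq] by (metis (no_types, lifting) linear_add[OF Aq] linear_sum[OF Aq] linear_scale[OF Aq] sum.cong)
  moreover have "(A ^^ q) ((A ^^ Suc (Suc k)) u) = 0" for k
  proof -
    have "(A ^^ q) ((A ^^ Suc (Suc k)) u) = (A ^^ (q + Suc (Suc k))) u" by (simp only: funpow_add o_apply)
    also have "q + Suc (Suc k) = k + m" by (simp add: q)
    also have "(A ^^ (k + m)) u = 0" using m linear_0[OF Aq] by (simp add: funpow_add)
    finally show ?thesis .
  qed
  ultimately have "(A ^^ q) (A u) = 0" by simp
  then have "(A ^^ (q + 1)) u = 0" using funpow_swap1[of A q u] by simp
  then show False using least[of "q + 1"] q by simp
qed

text \<open>The point is that \<open>k\<close> does not depend on the coefficients: one truncation
  has to serve for all elements of the span.\<close>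

lemma nilpotent_sum:
  fixes A :: "'i \<Rightarrow> 'v::real_vector \<Rightarrow> 'v"
  assumes "finite B" and lin: "\<And>i. i \<in> B \<Longrightarrow> linear (A i)"
    and com: "\<And>i j u. i \<in> B \<Longrightarrow> j \<in> B \<Longrightarrow> A i (A j u) = A j (A i u)"
    and nil: "\<And>i. i \<in> B \<Longrightarrow> \<exists>k. \<forall>u. (A i ^^ k) u = 0"
  shows "\<exists>k. \<forall>c u. ((\<lambda>u. \<Sum>i\<in>B. c i *\<^sub>R A i u) ^^ k) u = 0"
  using assms
proof (induction B)
  case empty
  show ?case by (intro exI[of _ 1]) simp
next
  case (insert i B)
  have "\<exists>k. \<forall>c u. ((\<lambda>u. \<Sum>i\<in>B. c i *\<^sub>R A i u) ^^ k) u = 0"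
    by (rule insert.IH) (use insert.prems in auto)
  then obtain k where k: "\<And>c u. ((\<lambda>u. \<Sum>i\<in>B. c i *\<^sub>R A i u) ^^ k) u = 0" by blast
  obtain m where m: "\<And>u. (A i ^^ m) u = 0" using insert.prems(3) by blast
  have Ai: "linear (A i)" using insert.prems by simp
  have "((\<lambda>u. c i *\<^sub>R A i u + (\<Sum>i\<in>B. c i *\<^sub>R A i u)) ^^ (m + k)) u = 0" for c u
  proof (rule nilpotent_add)
    show "linear (\<lambda>u. c i *\<^sub>R A i u)" using Ai by (intro linear_compose_scale_right)
    show "linear (\<lambda>u. \<Sum>i\<in>B. c i *\<^sub>R A i u)"
      using insert.prems(1) by (intro linear_compose_sum ballI linear_compose_scale_right) auto
    show "c i *\<^sub>R A i (\<Sum>j\<in>B. c j *\<^sub>R A j u) = (\<Sum>j\<in>B. c j *\<^sub>R A j (c i *\<^sub>R A i u))" for u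
      using insert.prems(1,2)
      by (simp add: linear_sum[OF Ai] linear_scale[OF Ai] linear_scale scaleR_sum_right mult.commute)
    have "((\<lambda>u. c i *\<^sub>R A i u) ^^ j) u = c i ^ j *\<^sub>R (A i ^^ j) u" for j u
      by (induction j) (simp_all add: linear_scale[OF Ai])
    then show "((\<lambda>u. c i *\<^sub>R A i u) ^^ m) u = 0" for u using m by simp
  qed (rule k)
  then show ?case using insert.hyps by auto
qed

lemma texp_zero: "M > 0 \<Longrightarrow> texp M (\<lambda>u. 0) u = u"
proof -
  have "((\<lambda>u. 0) ^^ k) u /\<^sub>R fact k = (if k = 0 then u else 0)" for k by (cases k) auto
  then show "M > 0 \<Longrightarrow> ?thesis" by (simp add: texp_def)
qed

section \<open>Abelian affine crystallographic actions\<close>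

text \<open>Properness enters as finiteness of orbits in compact sets. Since \<open>free\<close>
  identifies elements that agree at a single point, a finite set of orbit points also means a finite
  set of group elements.\<close>

locale crystallographic_action =
  fixes \<Gamma> :: "('v::euclidean_space \<Rightarrow> 'v) set"
  assumes linear_part: "T \<in> \<Gamma> \<Longrightarrow> linear (\<lambda>v. T v - T 0)"
    and inverse: "T \<in> \<Gamma> \<Longrightarrow> bij T \<and> inv T \<in> \<Gamma>"
    and compose: "S \<in> \<Gamma> \<Longrightarrow> T \<in> \<Gamma> \<Longrightarrow> S \<circ> T \<in> \<Gamma>"
    and nonempty: "\<Gamma> \<noteq> {}"
    and commute: "S \<in> \<Gamma> \<Longrightarrow> T \<in> \<Gamma> \<Longrightarrow> S (T x) = T (S x)"
    and free: "S \<in> \<Gamma> \<Longrightarrow> T \<in> \<Gamma> \<Longrightarrow> S x = T x \<Longrightarrow> S = T"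
    and discrete: "compact K \<Longrightarrow> finite ((\<lambda>T. T x) ` \<Gamma> \<inter> K)"
    and cocompact: "\<exists>K. compact K \<and> (\<forall>x. \<exists>T \<in> \<Gamma>. \<exists>y \<in> K. x = T y)"
begin

definition lin :: "('v \<Rightarrow> 'v) \<Rightarrow> 'v \<Rightarrow> 'v" where
  "lin T v = T v - T 0"

lemma lin: "T \<in> \<Gamma> \<Longrightarrow> linear (lin T)"
  using linear_part by (simp add: lin_def[abs_def])

lemma lin_diff:
  assumes "T \<in> \<Gamma>" shows "T x - T y = lin T (x - y)"
  using linear_diff[OF lin[OF assms], of x y] by (simp add: lin_def)

lemma lin_commute:
  assumes "S \<in> \<Gamma>" "T \<in> \<Gamma>" shows "lin S (lin T v) = lin T (lin S v)"
proof -
  have "lin S (lin T v) = S (T v) - S (T 0)" "lin T (lin S v) = T (S v) - T (S 0)"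
    using lin_diff[OF assms(1), of "T v" "T 0"] lin_diff[OF assms(2), of "S v" "S 0"] by (simp_all add: lin_def)
  then show ?thesis using commute[OF assms] by simp
qed

lemma continuous_on_action:
  assumes "T \<in> \<Gamma>" shows "continuous_on A T"
proof -
  have "continuous_on A (\<lambda>v. lin T v + T 0)"
    using linear_continuous_on[of "lin T"] lin[OF assms] by (intro continuous_intros) (simp add: linear_conv_bounded_linear)
  then show ?thesis by (simp add: lin_def)
qed

text \<open>
  In the Fitting decomposition of \<open>lin T - 1\<close> the group preserves an affine subspace parallel to
  the nilpotent part and acts linearly on the other part; properness leaves no room for the latter.
\<close>

lemma unipotent:
  assumes T: "T \<in> \<Gamma>"
  shows "\<exists>m. \<forall>v. ((\<lambda>v. lin T v - v) ^^ m) v = 0"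
proof -
  define N where "N v = lin T v - v" for v
  have N: "linear N" unfolding N_def[abs_def] using lin[OF T] by (intro linear_compose_sub linear_ident)
  obtain m where m: "m \<ge> 1" and m1: "range (N ^^ m) = N ` range (N ^^ m)"
    and m2: "range (N ^^ m) = (N ^^ m) ` range (N ^^ m)"
    and m3: "\<And>x. (N ^^ m) ((N ^^ m) x) = 0 \<Longrightarrow> (N ^^ m) x = 0"
    using linear_fitting[OF N] by metis
  define R where "R = N ^^ m"
  have R: "linear R" unfolding R_def by (rule linear_funpow[OF N])
  have RN: "R (N v) = N (R v)" for v unfolding R_def by (simp add: funpow_swap1)
  have NS: "N (lin S v) = lin S (N v)" if "S \<in> \<Gamma>" for S v
    using lin_commute[OF T that] linear_diff[OF lin[OF that]] by (simp add: N_def)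
  have RS: "R (lin S v) = lin S (R v)" if "S \<in> \<Gamma>" for S v
    unfolding R_def by (rule funpow_commute) (rule NS[OF that])
  have R0: "R x = 0" if "R (R x) = 0" for x using m3 that by (simp add: R_def)
  \<comment> \<open>\<open>N\<close> is injective on the range of \<open>R\<close>, so it cannot
    move a vector into the kernel of \<open>R\<close> from outside.\<close>
  have kerN: "R d = 0" if "R (N d) = 0" for d
  proof (rule R0)
    obtain k where "m = Suc k" using m by (metis One_nat_def Suc_le_D)
    then have "R (R d) = (N ^^ k) (N (R d))" by (simp add: R_def funpow_swap1)
    also have "\<dots> = 0" using that RN[of d] linear_0[OF linear_funpow[OF N]] by simp
    finally show "R (R d) = 0" .
  qed
  text \<open>A linear projection \<open>P\<close> onto the range of \<open>R\<close> along its kernel.\<close>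
  have R2: "linear (R \<circ> R)" using linear_compose[OF R R] .
  obtain g where g: "linear g" "\<And>x. x \<in> range (R \<circ> R) \<Longrightarrow> (R \<circ> R) (g x) = x"
    using linear_exists_right_inverse_on[OF R2 subspace_UNIV] by blast
  define P where "P x = R (g (R x))" for x
  have P: "linear P" unfolding P_def[abs_def]
    using linear_compose[OF R linear_compose[OF g(1) R, unfolded o_def]] linear_compose[OF R g(1)] 
      linear_compose[OF linear_compose[OF R g(1)] R] by (simp add: o_def)
  have RP: "R (P x) = R x" for x
  proof -
    have "R x \<in> range (R \<circ> R)" using m2 by (auto simp: R_def)
    then show ?thesis using g(2)[of "R x"] by (simp add: P_def)
  qed
  \<comment> \<open>\<open>R\<close> is injective on its range, so \<open>P x\<close> is the only
    element of the range with the same image under \<open>R\<close> as \<open>x\<close>.\<close>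
  have P_unique: "P x = R y" if "R x = R (R y)" for x y
  proof -
    have "R (R (g (R x) - y)) = 0" using RP[of x] that by (simp add: linear_diff[OF R] P_def)
    then have "R (g (R x) - y) = 0" by (rule R0)
    then show ?thesis by (simp add: P_def linear_diff[OF R])
  qed
  have PS: "P (lin S x) = lin S (P x)" if S: "S \<in> \<Gamma>" for S x
  proof -
    have "R (lin S x) = R (R (lin S (g (R x))))"
      using RP[of x] by (simp add: RS[OF S] P_def)
    then have "P (lin S x) = R (lin S (g (R x)))" by (rule P_unique)
    then show ?thesis by (simp add: P_def RS[OF S])
  qed
  text \<open>Solving \<open>N c = - P (T 0)\<close> moves the translation part of \<open>T\<close> into the kernel of \<open>R\<close>.\<close>
  have "P (T 0) \<in> N ` range R" using m1 by (auto simp: P_def R_def)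
  then obtain e where e: "P (T 0) = N e" by blast
  define c where "c = - e"
  have Rc: "R (T c - c) = 0"
  proof -
    have "T c - c = T 0 + N c" by (simp add: N_def lin_def)
    also have "\<dots> = T 0 - P (T 0)" using e linear_neg[OF N] by (simp add: c_def)
    finally show ?thesis by (simp add: linear_diff[OF R] RP)
  qed
  \<comment> \<open>Commutativity gives \<open>N (S c - c) = (lin S - 1) (T c - c)\<close>, which
    passes the property of \<open>T\<close> to every \<open>S\<close>: the affine subspace
    \<open>c + ker R\<close> is invariant under the whole group.\<close>
  have Sc: "R (S c - c) = 0" if S: "S \<in> \<Gamma>" for S
  proof (rule kerN)
    have "N (S c - c) = lin S (T c - c) - (T c - c)"
      using commute[OF S T, of c] by (simp add: N_def algebra_simps flip: lin_diff[OF S] lin_diff[OF T])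
    then show "R (N (S c - c)) = 0"
      using Rc linear_0[OF lin[OF S]] by (simp add: linear_diff[OF R] RS[OF S])
  qed
  \<comment> \<open>\<open>Q\<close> is the projection onto \<open>c + ker R\<close> along the range
    of \<open>R\<close>. It commutes with the group and collapses \<open>c + range R\<close> to the
    point \<open>c\<close>.\<close>
  define Q where "Q x = x - P (x - c)" for x
  have QS: "Q (S x) = S (Q x)" if S: "S \<in> \<Gamma>" for S x
  proof -
    have "P (S c - c) = R 0" using Sc[OF S] linear_0[OF R] by (intro P_unique) simp
    then have P0: "P (S c - c) = 0" using linear_0[OF R] by simp
    have "S x - c = lin S (x - c) + (S c - c)" by (simp flip: lin_diff[OF S])
    then have "P (S x - c) = lin S (P (x - c))"
      using P0 by (simp only: linear_add[OF P] PS[OF S] add_0_right)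
    also have "\<dots> = S x - S (Q x)" using lin_diff[OF S, of x "Q x"] by (simp add: Q_def)
    finally show ?thesis by (simp add: Q_def)
  qed
  have Qc: "Q (c + R y) = c" for y
    using P_unique[of "R y" y] by (simp add: Q_def)
  have contP: "continuous_on UNIV P" using P by (simp add: linear_continuous_on linear_conv_bounded_linear)
  have "continuous_on A (\<lambda>x. P (x - c))" for A
    by (rule continuous_on_compose2[OF contP]) (auto intro: continuous_intros)
  then have contQ: "continuous_on A Q" for A
    unfolding Q_def[abs_def] by (rule continuous_on_diff[OF continuous_on_id])
  obtain K where K: "compact K" "\<And>x. \<exists>T \<in> \<Gamma>. \<exists>y \<in> K. x = T y" using cocompact by blast
  define F where "F = {S \<in> \<Gamma>. S c \<in> Q ` K}"
  have "compact (Q ` K)" using K(1) contQ compact_continuous_image by blast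
  then have "finite ((\<lambda>S. S c) ` \<Gamma> \<inter> Q ` K)" by (rule discrete)
  then have "finite ((\<lambda>S. S c) ` F)" by (rule finite_subset[rotated]) (auto simp: F_def)
  moreover have "inj_on (\<lambda>S. S c) F" using free by (auto simp: inj_on_def F_def)
  ultimately have F: "finite F" by (rule finite_imageD)
  \<comment> \<open>If \<open>z = S k\<close> lies in \<open>c + range R\<close>, then
    \<open>Q\<close> gives \<open>inv S c = Q k\<close>, so \<open>inv S\<close> belongs to the
    finite set \<open>F\<close>. Finitely many images of \<open>K\<close> therefore cover
    \<open>c + range R\<close>; it is bounded, and a bounded linear subspace is zero.\<close>
  have "(+) c ` range R \<subseteq> (\<Union>S \<in> F. inv S ` K)"
  proof
    fix z assume "z \<in> (+) c ` range R"
    then obtain y where y: "z = c + R y" by auto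
    obtain S k where S: "S \<in> \<Gamma>" "k \<in> K" "z = S k" using K(2) by blast
    have bij: "bij S" "inv S \<in> \<Gamma>" using inverse[OF S(1)] by auto
    have k: "inv S z = k" using S bij by (simp add: bij_is_inj inv_f_f)
    have "inv S c = inv S (Q z)" using Qc y by simp
    also have "\<dots> = Q k" using QS[OF bij(2), of z] k by simp
    finally have "inv S \<in> F" using S(2) bij by (auto simp: F_def)
    moreover have "z = inv (inv S) k" using S bij by (simp add: inv_inv_eq)
    ultimately show "z \<in> (\<Union>S \<in> F. inv S ` K)" using S(2) by blast
  qed
  moreover have "bounded (\<Union>S \<in> F. inv S ` K)"
    using F K(1) inverse continuous_on_action
    by (intro bounded_UN ballI compact_imp_bounded compact_continuous_image) (auto simp: F_def)
  ultimately have "bounded ((+) c ` range R)" by (rule bounded_subset[rotated])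
  then have "bounded ((+) (- c) ` ((+) c ` range R))" by (rule bounded_translation)
  then have bdd: "bounded (range R)" by (simp add: image_image)
  have "R v = 0" for v
  proof (rule ccontr)
    assume nz: "R v \<noteq> 0"
    obtain B where B: "\<And>x. norm (R x) \<le> B" using bdd unfolding bounded_iff by auto
    have "norm (R (((B + 1) / norm (R v)) *\<^sub>R v)) = \<bar>B + 1\<bar>"
      using nz by (simp add: linear_scale[OF R] abs_divide)
    then show False using B[of "((B + 1) / norm (R v)) *\<^sub>R v"] by simp
  qed
  then show ?thesis unfolding R_def N_def[abs_def] by blast
qed

text \<open>If the span is proper, it lies in a maximal proper subspace \<open>X\<close> invariant
  under all linear parts. Unipotency makes every \<open>lin T - 1\<close> map into \<open>X\<close>,
  so a functional vanishing on \<open>X\<close> satisfies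
  \<open>f \<bullet> (T y - x) = f \<bullet> (y - x)\<close>. By \<open>cocompact\<close> its values
  are then those on a compact set, although a nonzero functional is unbounded.\<close>

lemma span_displacements:
  "span ((\<lambda>T. T x - x) ` \<Gamma>) = UNIV"
proof (rule ccontr)
  define W where "W = span ((\<lambda>T. T x - x) ` \<Gamma>)"
  define inva where "inva X \<longleftrightarrow> subspace X \<and> W \<subseteq> X \<and> X \<noteq> UNIV \<and> (\<forall>T \<in> \<Gamma>. \<forall>v \<in> X. lin T v \<in> X)" for X
  assume "span ((\<lambda>T. T x - x) ` \<Gamma>) \<noteq> UNIV"
  then have W: "W \<noteq> UNIV" by (simp add: W_def)
  have "lin S w \<in> W" if S: "S \<in> \<Gamma>" and w: "w \<in> W" for S w
    using w unfolding W_def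
  proof (induction rule: span_induct_alt)
    case base show ?case using linear_0[OF lin[OF S]] by (simp add: span_zero)
  next
    case (step a v y)
    then obtain T where T: "T \<in> \<Gamma>" "v = T x - x" by blast
    have "lin S v = ((S \<circ> T) x - x) - (S x - x)" using lin_diff[OF S, of "T x" x] T by simp
    moreover have "(S \<circ> T) x - x \<in> W" "S x - x \<in> W"
      unfolding W_def using imageI[OF compose[OF S T(1)], of "\<lambda>T. T x - x"] imageI[OF S, of "\<lambda>T. T x - x"]
      by (auto intro: span_base)
    ultimately have "lin S v \<in> W" unfolding W_def by (metis span_diff)
    then show ?case using step by (simp add: linear_add[OF lin[OF S]] linear_scale[OF lin[OF S]] W_def span_add span_scale)
  qed
  then have "inva W" using W by (auto simp: inva_def W_def)
  then obtain X where X: "inva X" and max: "\<And>Y. inva Y \<Longrightarrow> dim Y \<le> dim X"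
    using ex_has_greatest_nat[of inva W dim "Suc DIM('v)"] le_imp_less_Suc[OF dim_subset_UNIV] by blast
  have sX: "subspace X" and WX: "W \<subseteq> X" using X by (auto simp: inva_def)
  have NX: "lin T v - v \<in> X" if T: "T \<in> \<Gamma>" for T v
  proof -
    define N where "N v = lin T v - v" for v
    have N: "linear N" unfolding N_def[abs_def] using lin[OF T] by (intro linear_compose_sub linear_ident)
    obtain m where m: "\<And>v. (N ^^ m) v = 0" using unipotent[OF T] unfolding N_def[abs_def] by blast
    \<comment> \<open>\<open>Y\<close> is again invariant and contains \<open>X\<close>; once it is
      proper, maximality forces \<open>range N \<subseteq> X\<close>.\<close>
    define Y where "Y = {a + b | a b. a \<in> X \<and> b \<in> range N}"
    have XY: "X \<subseteq> Y" using linear_0[OF N] by (force simp: Y_def)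
    have sY: "subspace Y"
      unfolding Y_def by (rule subspace_sums[OF sX linear_subspace_image[OF N subspace_UNIV]])
    have "lin S w \<in> Y" if S: "S \<in> \<Gamma>" and w: "w \<in> Y" for S w
    proof -
      obtain a b where ab: "a \<in> X" "w = a + N b" using w by (auto simp: Y_def)
      have "lin S w = lin S a + N (lin S b)"
        using ab lin_commute[OF S T] by (simp add: N_def linear_add[OF lin[OF S]] linear_diff[OF lin[OF S]])
      then show ?thesis using X ab S unfolding Y_def inva_def by blast
    qed
    moreover have "Y \<noteq> UNIV"
    proof
      assume Y: "Y = UNIV"
      have NXX: "N a \<in> X" if "a \<in> X" for a
        using X that T unfolding inva_def N_def by (simp add: subspace_diff)
      \<comment> \<open>Iterating \<open>v = a + N b\<close> moves the remainder into ever higher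
        powers of \<open>N\<close>, and these vanish.\<close>
      have "\<exists>a \<in> X. \<exists>b. v = a + (N ^^ k) b" for k v
      proof (induction k arbitrary: v)
        case 0 then show ?case using subspace_0[OF sX] by (intro bexI[of _ 0]) auto
      next
        case (Suc k)
        obtain a b where ab: "a \<in> X" "v = a + N b" using Y by (force simp: Y_def)
        obtain a' b' where ab': "a' \<in> X" "b = a' + (N ^^ k) b'" using Suc by blast
        have "v = (a + N a') + (N ^^ Suc k) b'" using ab ab' by (simp add: linear_add[OF N])
        then show ?case using ab ab' NXX subspace_add[OF sX] by blast
      qed
      from this[of _ m] have "X = UNIV" using m by auto
      then show False using X by (simp add: inva_def)
    qed
    ultimately have "inva Y" using XY WX sY by (auto simp: inva_def)
    from subspace_dim_equal[OF sX sY XY max[OF this]] have "X = Y" .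
    moreover have "0 + N v \<in> Y" unfolding Y_def using subspace_0[OF sX] by blast
    ultimately show ?thesis by (simp add: N_def)
  qed
  have "span X \<noteq> UNIV" unfolding span_eq_iff[THEN iffD2, OF sX] using X by (simp add: inva_def)
  then have "dim X < DIM('v)" using dim_eq_full[of X] dim_subset_UNIV[of X] by linarith
  then obtain f where f: "f \<noteq> 0" "\<And>y. y \<in> span X \<Longrightarrow> orthogonal f y"
    using orthogonal_to_subspace_exists by metis
  have fX: "f \<bullet> y = 0" if "y \<in> X" for y using f(2)[of y] that span_base by (auto simp: orthogonal_def)
  have inv: "f \<bullet> (T y - x) = f \<bullet> (y - x)" if T: "T \<in> \<Gamma>" for T y
  proof -
    have "T y - x = (lin T (y - x) - (y - x)) + (T x - x) + (y - x)" by (simp flip: lin_diff[OF T])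
    then have "f \<bullet> (T y - x) = f \<bullet> (lin T (y - x) - (y - x)) + f \<bullet> (T x - x) + f \<bullet> (y - x)"
      by (simp only: inner_add_right)
    moreover have "T x - x \<in> X" using T WX by (auto simp: W_def intro: span_base)
    ultimately show ?thesis using NX[OF T] fX by simp
  qed
  obtain K where K: "compact K" "\<And>x. \<exists>T \<in> \<Gamma>. \<exists>y \<in> K. x = T y" using cocompact by blast
  obtain b where b: "\<And>y. y \<in> K \<Longrightarrow> norm y \<le> b" using compact_imp_bounded[OF K(1)] unfolding bounded_iff by auto
  \<comment> \<open>On the point \<open>x + (s / (f \<bullet> f)) *\<^sub>R f\<close> the functional
    takes the value \<open>s\<close>, one more than its bound on \<open>K\<close>.\<close>
  define s where "s = norm f * (b + norm x) + 1"
  obtain T y where Ty: "T \<in> \<Gamma>" "y \<in> K" "x + (s / (f \<bullet> f)) *\<^sub>R f = T y" using K(2) by blast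
  have "s = f \<bullet> (T y - x)" using f(1) by (simp flip: Ty(3))
  also have "\<dots> = f \<bullet> (y - x)" by (rule inv[OF Ty(1)])
  also have "\<dots> \<le> norm f * norm (y - x)" by (rule norm_cauchy_schwarz)
  also have "\<dots> \<le> norm f * (b + norm x)"
    using b[OF Ty(2)] norm_triangle_ineq4[of y x] by (intro mult_left_mono) auto
  finally show False by (simp add: s_def)
qed


text \<open>
  The affine maps are linearised on \<open>real \<times> 'v\<close>, where \<open>v\<close> is the point \<open>(1, v)\<close>.  The span of
  their nilpotent parts is an abelian Lie algebra of dimension \<open>DIM('v)\<close>, evaluation at a point
  is an isomorphism onto \<open>'v\<close>, and so all orbits of its exponential are open.
\<close>

lemma affine_exponential:
  obtains \<psi> \<psi>' :: "'v \<Rightarrow> 'v" where "homeomorphism UNIV UNIV \<psi> \<psi>'"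
    "\<And>T. T \<in> \<Gamma> \<Longrightarrow> \<exists>l. \<forall>x. T (\<psi> x) = \<psi> (x + l)"
proof -
  \<comment> \<open>As a linear map on pairs, \<open>T\<close> sends \<open>(s, v)\<close> to
    \<open>(s, s *\<^sub>R T 0 + lin T v)\<close>; \<open>nil T\<close> is this map minus the
    identity.\<close>
  define nil :: "('v \<Rightarrow> 'v) \<Rightarrow> real \<times> 'v \<Rightarrow> real \<times> 'v"
    where "nil T u = (0, fst u *\<^sub>R T 0 + lin T (snd u) - snd u)" for T u
  have nil_lin: "linear (nil T)" if "T \<in> \<Gamma>" for T
    using linear_add[OF lin[OF that]] linear_scale[OF lin[OF that]]
    by (intro linearI) (auto simp: nil_def algebra_simps)
  have nil_com: "nil S (nil T u) = nil T (nil S u)" if "S \<in> \<Gamma>" "T \<in> \<Gamma>" for S T u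
  proof -
    have "lin S (T 0) - T 0 = lin T (S 0) - S 0" using commute[OF that, of 0] by (simp add: lin_def)
    then have "fst u *\<^sub>R lin S (T 0) - fst u *\<^sub>R T 0 = fst u *\<^sub>R lin T (S 0) - fst u *\<^sub>R S 0"
      by (metis scaleR_diff_right)
    then show ?thesis
      using that by (simp add: nil_def linear_add[OF lin] linear_diff[OF lin] linear_scale[OF lin] lin_commute[OF that])
  qed
  have nil_nil: "\<exists>k. \<forall>u. (nil T ^^ k) u = 0" if T: "T \<in> \<Gamma>" for T
  proof -
    obtain m where m: "\<And>v. ((\<lambda>v. lin T v - v) ^^ m) v = 0" using unipotent[OF T] by blast
    \<comment> \<open>A first application kills the real component, and on the rest
      \<open>nil T\<close> is \<open>lin T - 1\<close>; hence the exponent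
      \<open>Suc m\<close>.\<close>
    have "(nil T ^^ k) (0, v) = (0, ((\<lambda>v. lin T v - v) ^^ k) v)" for k v
      by (induction k) (simp_all add: nil_def)
    moreover have "\<exists>v. nil T u = (0, v)" for u by (simp add: nil_def)
    ultimately have "(nil T ^^ m) (nil T u) = 0" for u using m by (metis zero_prod_def)
    then show ?thesis by (intro exI[of _ "Suc m"]) (simp add: funpow_swap1)
  qed
  obtain B where B: "B \<subseteq> (\<lambda>T. T 0) ` \<Gamma>" "independent B" "(\<lambda>T. T 0) ` \<Gamma> \<subseteq> span B"
    using maximal_independent_subset by metis
  have spanB: "span B = UNIV"
    using span_displacements[of 0] span_minimal[OF B(3) subspace_span] by auto
  have finB: "finite B" using B(2) by (rule independent_imp_finite)
  have "\<forall>v \<in> B. \<exists>T. T \<in> \<Gamma> \<and> T 0 = v" using B(1) by auto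
  then obtain t where t: "\<And>v. v \<in> B \<Longrightarrow> t v \<in> \<Gamma>" "\<And>v. v \<in> B \<Longrightarrow> t v 0 = v" by metis
  \<comment> \<open>\<open>hat x\<close> is the combination of the chosen \<open>nil (t v)\<close>
    that takes \<open>(1, 0)\<close> to \<open>(0, x)\<close>. It is linear in \<open>x\<close>, so
    that its exponential is a homomorphism on the additive group \<open>'v\<close>.\<close>
  define hat where "hat x u = (\<Sum>v\<in>B. representation B x v *\<^sub>R nil (t v) u)" for x u
  have hat_lin: "linear (hat x)" for x
    unfolding hat_def[abs_def] using nil_lin t by (intro linear_compose_sum ballI linear_compose_scale_right) auto
  have hat_nil: "hat x (nil S u) = nil S (hat x u)" if "S \<in> \<Gamma>" for x S u
    using that t by (simp add: hat_def linear_sum[OF nil_lin] linear_scale[OF nil_lin] nil_com)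
  have hat_hat: "hat x (hat y u) = hat y (hat x u)" for x y u
    using t by (simp add: hat_def[of y] linear_sum[OF hat_lin] linear_scale[OF hat_lin] hat_nil)
  have hat_add: "hat (x + y) = (\<lambda>u. hat x u + hat y u)" for x y
    by (simp add: fun_eq_iff hat_def representation_add[OF B(2)] spanB scaleR_add_left sum.distrib)
  have hat_0: "hat 0 = (\<lambda>u. 0)"
    by (simp add: fun_eq_iff hat_def representation_zero)
  have hat_eval: "hat x (1, 0) = (0, x)" for x
  proof -
    have "hat x (1, 0) = (\<Sum>v\<in>B. representation B x v *\<^sub>R (0, v))"
      unfolding hat_def using t lin by (intro sum.cong refl) (simp add: nil_def linear_0)
    also have "\<dots> = (0, \<Sum>v\<in>B. representation B x v *\<^sub>R v)"
      by (simp add: prod_eq_iff fst_sum snd_sum)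
    also have "(\<Sum>v\<in>B. representation B x v *\<^sub>R v) = x"
      using sum_representation_eq[OF B(2) _ finB order_refl] spanB by simp
    finally show ?thesis .
  qed
  have "\<exists>k. \<forall>c u. ((\<lambda>u. \<Sum>v\<in>B. c v *\<^sub>R nil (t v) u) ^^ k) u = 0"
    by (rule nilpotent_sum[OF finB]) (use nil_lin nil_com nil_nil t in auto)
  then obtain K where K: "\<And>c u. ((\<lambda>u. \<Sum>v\<in>B. c v *\<^sub>R nil (t v) u) ^^ K) u = 0" by blast
  have hatK: "(hat x ^^ K) u = 0" for x u unfolding hat_def[abs_def] by (rule K)
  \<comment> \<open>\<open>2 * K\<close> is the truncation required by \<open>texp_add\<close>; the
    additional 2 secures the linear term for \<open>texp_fixed\<close> even when
    \<open>K = 0\<close>.\<close>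
  define \<Phi> where "\<Phi> x = texp (2 * K + 2) (hat x)" for x
  have \<Phi>_add: "\<Phi> (x + y) u = \<Phi> x (\<Phi> y u)" for x y u
    unfolding \<Phi>_def hat_add by (rule texp_add[where K = K]) (simp_all add: hat_lin hat_hat hatK)
  have \<Phi>_0: "\<Phi> 0 u = u" for u by (simp add: \<Phi>_def hat_0 texp_zero)
  have \<Phi>_nil: "\<Phi> x (nil T u) = nil T (\<Phi> x u)" if "T \<in> \<Gamma>" for x T u
    unfolding \<Phi>_def using nil_lin hat_nil that by (intro texp_commute) auto
  have \<Phi>_lin: "linear (\<Phi> x)" for x unfolding \<Phi>_def by (intro texp_linear hat_lin)
  have fst_\<Phi>: "fst (\<Phi> x u) = fst u" for x u
  proof -
    have "fst (hat x u) = 0" for u by (simp add: hat_def nil_def fst_sum)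
    then have "fst ((hat x ^^ k) u /\<^sub>R fact k) = (if k = 0 then fst u else 0)" for k by (cases k) auto
    then show ?thesis by (simp add: \<Phi>_def texp_def fst_sum del: sum.lessThan_Suc)
  qed
  have cont_hat: "continuous_on UNIV (\<lambda>x. (hat x ^^ k) u)" for k u
  proof (induction k)
    case (Suc k)
    have 1: "continuous_on UNIV (\<lambda>x. representation B x v)" for v
      using B(2) spanB by (intro linear_continuous_on)
        (auto simp: linear_conv_bounded_linear[symmetric] representation_add representation_scale intro!: linearI)
    have 2: "continuous_on UNIV (nil (t v))" if "v \<in> B" for v
      using nil_lin[OF t(1)[OF that]] by (simp add: linear_continuous_on linear_conv_bounded_linear)
    have "continuous_on UNIV (\<lambda>x. \<Sum>v\<in>B. representation B x v *\<^sub>R nil (t v) ((hat x ^^ k) u))"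
      using Suc by (intro continuous_intros 1 continuous_on_compose2[OF 2]) auto
    moreover have "(hat x ^^ Suc k) u = (\<Sum>v\<in>B. representation B x v *\<^sub>R nil (t v) ((hat x ^^ k) u))" for x
      unfolding funpow.simps o_apply by (rule hat_def)
    ultimately show ?case by (simp only:)
  qed simp
  have cont_\<Phi>: "continuous_on UNIV (\<lambda>x. \<Phi> x u)" for u
    unfolding \<Phi>_def texp_def by (intro continuous_intros cont_hat)
  define act where "act x y = snd (\<Phi> x (1, y))" for x y
  have \<Phi>_act: "\<Phi> x (1, y) = (1, act x y)" for x y using fst_\<Phi>[of x "(1, y)"] by (simp add: act_def prod_eq_iff)
  have act_add: "act (x + x') y = act x (act x' y)" for x x' y using \<Phi>_add[of x x' "(1, y)"] by (simp add: \<Phi>_act)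
  have act_0: "act 0 y = y" for y by (simp add: act_def \<Phi>_0)
  have aff: "(1, T y) = (1, y) + nil T (1, y)" for T y by (simp add: nil_def lin_def)
  have act_T: "act x (T y) = T (act x y)" if T: "T \<in> \<Gamma>" for x y T
  proof -
    have "\<Phi> x (1, T y) = \<Phi> x ((1, y) + nil T (1, y))" by (simp only: aff[of T y])
    also have "\<dots> = (1, act x y) + nil T (1, act x y)" by (simp only: linear_add[OF \<Phi>_lin] \<Phi>_act \<Phi>_nil[OF T])
    also have "\<dots> = (1, T (act x y))" by (simp only: aff[of T "act x y"])
    finally show ?thesis by (simp add: \<Phi>_act)
  qed
  \<comment> \<open>If \<open>z\<close> fixes \<open>y\<close>, then \<open>hat z\<close> kills
    \<open>(1, y)\<close>. Commuting with \<open>nil T\<close>, it also kills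
    \<open>(0, T y - y)\<close>; these vectors span the second factor, so \<open>hat z\<close>
    vanishes on \<open>(1, 0)\<close> and \<open>z = 0\<close>.\<close>
  have act_inj: "inj (\<lambda>x. act x y)" for y
  proof (rule injI)
    fix x x' assume eq: "act x y = act x' y"
    define z where "z = x - x'"
    have "act z y = act (- x') (act x y)" by (simp add: z_def flip: act_add)
    also have "\<dots> = y" by (simp add: eq act_0 flip: act_add)
    finally have "\<Phi> z (1, y) = (1, y)" by (simp add: \<Phi>_act)
    then have zy: "hat z (1, y) = 0"
      unfolding \<Phi>_def using hatK by (intro texp_fixed[OF hat_lin]) auto
    have "hat z (0, w) = 0" for w
    proof -
      have "w \<in> span ((\<lambda>T. T y - y) ` \<Gamma>)" by (simp add: span_displacements)
      then show ?thesis
      proof (induction rule: span_induct_alt)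
        case base show ?case using linear_0[OF hat_lin] by (simp add: zero_prod_def)
      next
        case (step c v w)
        then obtain T where T: "T \<in> \<Gamma>" "v = T y - y" by blast
        have "(0, v) = nil T (1, y)" using aff[of T y] T by (simp add: prod_eq_iff)
        then have "hat z (0, v) = 0" using hat_nil[OF T(1)] zy linear_0[OF nil_lin[OF T(1)]] by simp
        moreover have "(0, c *\<^sub>R v + w) = c *\<^sub>R (0, v) + (0::real, w)" by simp
        ultimately show ?case using step.IH by (metis add_0 linear_add[OF hat_lin] linear_scale[OF hat_lin] scaleR_zero_right)
      qed
    qed
    then have "hat z ((1, y) - (0, y)) = 0" using zy by (simp only: linear_diff[OF hat_lin]) simp
    then show "x = x'" using hat_eval[of z] by (simp add: z_def zero_prod_def)
  qed
  have act_cont: "continuous_on UNIV (\<lambda>x. act x y)" for y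
    unfolding act_def by (intro continuous_intros cont_\<Phi>)
  have act_open: "open (range (\<lambda>x. act x y))" for y
    by (rule invariance_of_domain[OF act_cont open_UNIV act_inj])
  define \<psi> where "\<psi> x = act x 0" for x
  \<comment> \<open>The complement of one orbit is a union of orbits and hence open; by
    connectedness there is only one orbit.\<close>
  have "- range \<psi> = (\<Union>y \<in> - range \<psi>. range (\<lambda>x. act x y))"
  proof (intro equalityI subsetI)
    fix y assume "y \<in> - range \<psi>"
    then show "y \<in> (\<Union>y \<in> - range \<psi>. range (\<lambda>x. act x y))" using act_0[of y] by (metis UN_iff rangeI)
  next
    fix w assume "w \<in> (\<Union>y \<in> - range \<psi>. range (\<lambda>x. act x y))"
    then obtain x y where y: "y \<notin> range \<psi>" "w = act x y" by blast
    have "w \<notin> range \<psi>"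
    proof
      assume "w \<in> range \<psi>"
      then obtain z where "w = act z 0" by (auto simp: \<psi>_def)
      then have "act (- x) (act x y) = act (- x) (act z 0)" using y by simp
      then have "y = act (- x + z) 0" by (simp add: act_0 flip: act_add)
      then show False using y by (auto simp: \<psi>_def)
    qed
    then show "w \<in> - range \<psi>" by simp
  qed
  also have "open \<dots>" using act_open by blast
  finally have "closed (range \<psi>)" by (simp add: closed_def)
  moreover have "open (range \<psi>)" using act_open[of 0] by (simp add: \<psi>_def[abs_def])
  ultimately have surj: "range \<psi> = UNIV" using clopen[of "range \<psi>"] by auto
  obtain \<psi>' where "homeomorphism UNIV (range \<psi>) \<psi> \<psi>'"
    using invariance_of_domain_homeomorphism[of UNIV \<psi>] act_cont[of 0] act_inj[of 0]
    unfolding \<psi>_def[abs_def] by auto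
  then have "homeomorphism UNIV UNIV \<psi> \<psi>'" by (simp add: surj)
  moreover have "\<exists>l. \<forall>x. T (\<psi> x) = \<psi> (x + l)" if T: "T \<in> \<Gamma>" for T
  proof -
    obtain l where "T 0 = \<psi> l" using surj by (metis surjD)
    then have "T (\<psi> x) = \<psi> (x + l)" for x
      using act_T[OF T, of x 0] by (simp add: \<psi>_def act_add)
    then show ?thesis by blast
  qed
  ultimately show thesis by (rule that)
qed

end

section \<open>Lattices\<close>

lemma subgroup_int_comb:
  fixes \<Lambda> :: "'v::real_vector set" and c :: "'v \<Rightarrow> int"
  assumes zero: "0 \<in> \<Lambda>" and diff: "\<And>x y. x \<in> \<Lambda> \<Longrightarrow> y \<in> \<Lambda> \<Longrightarrow> x - y \<in> \<Lambda>"
    and "finite X" "X \<subseteq> \<Lambda>"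
  shows "(\<Sum>b\<in>X. of_int (c b) *\<^sub>R b) \<in> \<Lambda>"
proof -
  have add: "x + y \<in> \<Lambda>" if "x \<in> \<Lambda>" "y \<in> \<Lambda>" for x y
    using diff[OF that(1) diff[OF zero that(2)]] by simp
  have nat_mult: "of_nat n *\<^sub>R x \<in> \<Lambda>" if "x \<in> \<Lambda>" for n x
    by (induction n) (use zero add that in \<open>auto simp: scaleR_add_left\<close>)
  have int_mult: "of_int k *\<^sub>R x \<in> \<Lambda>" if "x \<in> \<Lambda>" for k x
  proof (cases k)
    case (nonneg n) then show ?thesis using nat_mult[OF that, of n] by simp
  next
    case (neg n)
  have "of_int k *\<^sub>R x = 0 - real (Suc n) *\<^sub>R x" unfolding neg by (simp add: algebra_simps)
  then show ?thesis using diff[OF zero nat_mult[OF that, of "Suc n"]] by (simp only:)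
  qed
  show ?thesis using assms(3,4) by (induction X) (auto intro: zero add int_mult)
qed

text \<open>Induction on the vectors spanning the subspace. For a new vector \<open>v\<close>, let
  \<open>\<kappa>\<close> be the coefficient at \<open>v\<close>. By discreteness its least positive
  value on the subgroup is attained at some \<open>w\<close>, which takes the place of
  \<open>v\<close> in the integral basis; division with remainder by \<open>\<kappa> w\<close>
  reduces the other elements to the previous subspace.\<close>

lemma discrete_subgroup_basis_step:
  fixes \<Lambda> :: "'v::euclidean_space set"
  assumes zero: "0 \<in> \<Lambda>" and diff: "\<And>x y. x \<in> \<Lambda> \<Longrightarrow> y \<in> \<Lambda> \<Longrightarrow> x - y \<in> \<Lambda>"
    and discrete: "\<And>r. finite (\<Lambda> \<inter> cball 0 r)"
    and "finite B0" "independent B0" "B0 \<subseteq> \<Lambda>"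
  shows "\<exists>B. finite B \<and> independent B \<and> B \<subseteq> \<Lambda> \<and> span B = span B0 \<and>
    (\<forall>x \<in> \<Lambda> \<inter> span B0. \<exists>c::'v \<Rightarrow> int. x = (\<Sum>b\<in>B. of_int (c b) *\<^sub>R b))"
  using assms(4-6)
proof (induction B0)
  case empty
  show ?case by (intro exI[of _ "{}"] conjI independent_empty) auto
next
  case (insert v B0)
  note comb = subgroup_int_comb[OF zero diff]
  have int_mult: "of_int k *\<^sub>R x \<in> \<Lambda>" if "x \<in> \<Lambda>" for k x
    using comb[of "{x}" "\<lambda>_. k"] that by simp
  have vB0: "v \<notin> span B0" using insert by (metis independent_insert)
  obtain B where B: "finite B" "independent B" "B \<subseteq> \<Lambda>" "span B = span B0"
    "\<And>x. x \<in> \<Lambda> \<inter> span B0 \<Longrightarrow> \<exists>c::'v \<Rightarrow> int. x = (\<Sum>b\<in>B. of_int (c b) *\<^sub>R b)"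
    using insert by (metis independent_insert insert_subset)
  have vB: "v \<notin> B" using vB0 B(4) span_base by metis
  have "independent (insert v B)" using B vB0 by (simp add: independent_insert)
  then obtain \<kappa> :: "'v \<Rightarrow> real" where \<kappa>: "linear \<kappa>" "\<And>b. b \<in> insert v B \<Longrightarrow> \<kappa> b = (if b = v then 1 else 0)"
    using linear_independent_extend[of "insert v B" "\<lambda>b. if b = v then 1 else 0 :: real"] by blast
  have \<kappa>B: "\<kappa> x = 0" if "x \<in> span B" for x
    using that by (rule linear_eq_0_on_span[OF \<kappa>(1), rotated]) (use \<kappa>(2) vB in auto)
  have \<kappa>v: "\<kappa> v = 1" using \<kappa>(2) by simp
  have brk: "x - \<kappa> x *\<^sub>R v \<in> span B" if x: "x \<in> span (insert v B0)" for x
  proof -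
    obtain k where k: "x - k *\<^sub>R v \<in> span B" using x unfolding span_breakdown_eq B(4) by blast
    then have "\<kappa> x = k" using \<kappa>B[OF k] by (simp add: linear_diff[OF \<kappa>(1)] linear_scale[OF \<kappa>(1)] \<kappa>v)
    then show ?thesis using k by simp
  qed
  define S where "S = {x \<in> \<Lambda> \<inter> span (insert v B0). \<kappa> x > 0}"
  \<comment> \<open>After reduction the coefficient at \<open>v\<close> is in the half-open interval
    from 0 to 1 and the others are fractional parts, so \<open>r\<close> bounds the norm.\<close>
  define r where "r = norm v + (\<Sum>b\<in>B. norm b)"
  have vS: "v \<in> S" using insert.prems \<kappa>v by (auto simp: S_def span_base)
  have "finite (S \<inter> cball 0 r)" using discrete[of r] by (rule finite_subset[rotated]) (auto simp: S_def)
  moreover have "v \<in> S \<inter> cball 0 r" using vS by (simp add: r_def sum_nonneg)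
  ultimately obtain w where w: "w \<in> S \<inter> cball 0 r" "\<And>x. x \<in> S \<inter> cball 0 r \<Longrightarrow> \<kappa> w \<le> \<kappa> x"
    using ex_is_arg_min_if_finite[of "S \<inter> cball 0 r" \<kappa>] unfolding is_arg_min_linorder by blast
  text \<open>Subtracting integral parts of the other coefficients, elements of \<open>S\<close> with small \<open>\<kappa>\<close>
    may be assumed to be bounded, so that \<open>\<kappa>\<close> attains its minimum on \<open>S\<close>.\<close>
  have min: "\<kappa> w \<le> \<kappa> x" if x: "x \<in> S" for x
  proof (cases "\<kappa> x \<le> 1")
    case True
    have "x - \<kappa> x *\<^sub>R v \<in> span B" using brk x by (auto simp: S_def)
    then obtain u where u: "x - \<kappa> x *\<^sub>R v = (\<Sum>b\<in>B. u b *\<^sub>R b)" using span_finite[OF B(1)] by auto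
    define s where "s = (\<Sum>b\<in>B. of_int \<lfloor>u b\<rfloor> *\<^sub>R b)"
    have s: "s \<in> \<Lambda>" "s \<in> span B" unfolding s_def using comb[OF _ _ B(1,3)] by (auto intro: span_sum span_scale span_base)
    have k: "\<kappa> (x - s) = \<kappa> x" using \<kappa>B[OF s(2)] by (simp add: linear_diff[OF \<kappa>(1)])
    have "s \<in> span (insert v B0)" using s(2) B(4) span_mono[of B0 "insert v B0"] by auto
    then have "x - s \<in> S" using x s k diff by (auto simp: S_def intro: span_diff)
    moreover have "norm (x - s) \<le> r"
    proof -
      have "x - s = \<kappa> x *\<^sub>R v + (\<Sum>b\<in>B. frac (u b) *\<^sub>R b)"
        using u by (simp add: s_def frac_def scaleR_diff_left sum_subtractf algebra_simps)
      also have "norm \<dots> \<le> norm (\<kappa> x *\<^sub>R v) + (\<Sum>b\<in>B. norm (frac (u b) *\<^sub>R b))"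
        by (rule order_trans[OF norm_triangle_ineq add_left_mono[OF norm_sum]])
      also have "\<dots> \<le> r"
        unfolding r_def
      proof (intro add_mono sum_mono)
        show "norm (\<kappa> x *\<^sub>R v) \<le> norm v" using True x by (simp add: S_def mult_left_le_one_le)
        show "norm (frac (u b) *\<^sub>R b) \<le> norm b" for b
          using frac_ge_0[of "u b"] frac_lt_1[of "u b"] by (simp add: mult_left_le_one_le)
      qed
      finally show ?thesis .
    qed
    ultimately show ?thesis using w(2)[of "x - s"] k by simp
  next
    case False
    then show ?thesis using w(2)[OF \<open>v \<in> S \<inter> cball 0 r\<close>] \<kappa>v by simp
  qed
  have wS: "w \<in> \<Lambda>" "w \<in> span (insert v B0)" "\<kappa> w > 0" using w by (auto simp: S_def)
  have wB: "w \<notin> span B" using \<kappa>B[of w] wS by auto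
  have wB': "w \<notin> B" using wB span_base by metis
  have "span (insert w B) = span (insert v B0)"
  proof (rule subspace_dim_equal)
    have "insert w B \<subseteq> span (insert v B0)"
      using wS B(4) span_mono[of B0 "insert v B0"] span_superset[of B] by auto
    then show "span (insert w B) \<subseteq> span (insert v B0)" by (rule span_minimal) simp
    have "dim (insert w B) = Suc (dim B)" "dim (insert v B0) = Suc (dim B0)"
      using wB vB0 by (simp_all add: dim_insert)
    then show "dim (span (insert v B0)) \<le> dim (span (insert w B))"
      using B(4) by (metis dim_span order_refl)
  qed auto
  moreover have "\<exists>c::'v \<Rightarrow> int. x = (\<Sum>b\<in>insert w B. of_int (c b) *\<^sub>R b)" if x: "x \<in> \<Lambda> \<inter> span (insert v B0)" for x
  proof -
    \<comment> \<open>The remainder \<open>y\<close> has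
      \<open>0 \<le> \<kappa> y < \<kappa> w\<close>, so minimality of \<open>w\<close> leaves only
      \<open>\<kappa> y = 0\<close>.\<close>
    define q where "q = \<lfloor>\<kappa> x / \<kappa> w\<rfloor>"
    define y where "y = x - of_int q *\<^sub>R w"
    have y: "y \<in> \<Lambda> \<inter> span (insert v B0)" using x wS int_mult diff by (auto simp: y_def span_diff span_scale)
    have "\<kappa> y = \<kappa> w * frac (\<kappa> x / \<kappa> w)"
      using wS(3) by (simp add: y_def linear_diff[OF \<kappa>(1)] linear_scale[OF \<kappa>(1)] frac_def q_def field_simps)
    then have "0 \<le> \<kappa> y" "\<kappa> y < \<kappa> w" using wS(3) frac_ge_0 frac_lt_1 by simp_all
    then have "\<kappa> y = 0" using min[of y] y by (force simp: S_def)
    then have "y \<in> span B" using brk[of y] y by simp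
    then obtain c :: "'v \<Rightarrow> int" where c: "y = (\<Sum>b\<in>B. of_int (c b) *\<^sub>R b)" using B(5)[of y] B(4) y by auto
    have "(\<Sum>b\<in>B. of_int ((c(w := q)) b) *\<^sub>R b) = (\<Sum>b\<in>B. of_int (c b) *\<^sub>R b)"
      using wB' by (intro sum.cong) auto
    then have "x = (\<Sum>b\<in>insert w B. of_int ((c(w := q)) b) *\<^sub>R b)"
      using B(1) wB' c by (simp add: y_def diff_eq_eq add.commute)
    then show ?thesis by blast
  qed
  ultimately show ?case
    using B wB wS by (intro exI[of _ "insert w B"]) (auto simp: independent_insert)
qed

lemma lattice_basis:
  fixes \<Lambda> :: "'v::euclidean_space set"
  assumes "0 \<in> \<Lambda>" and "\<And>x y. x \<in> \<Lambda> \<Longrightarrow> y \<in> \<Lambda> \<Longrightarrow> x - y \<in> \<Lambda>"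
    and "\<And>r. finite (\<Lambda> \<inter> cball 0 r)" and span: "span \<Lambda> = UNIV"
  obtains B where "finite B" "independent B" "B \<subseteq> \<Lambda>" "span B = UNIV"
    "\<And>x. x \<in> \<Lambda> \<Longrightarrow> \<exists>c::'v \<Rightarrow> int. x = (\<Sum>b\<in>B. of_int (c b) *\<^sub>R b)"
proof -
  obtain B0 where B0: "B0 \<subseteq> \<Lambda>" "independent B0" "\<Lambda> \<subseteq> span B0" using maximal_independent_subset by metis
  then have "span B0 = UNIV" using span span_minimal[OF B0(3) subspace_span] by auto
  then show thesis
    using discrete_subgroup_basis_step[OF assms(1-3) independent_imp_finite[OF B0(2)] B0(2,1)] that by auto
qed

section \<open>Conjugation of the group to a lattice of translations\<close>

context crystallographic_action
begin

text \<open>The translation vectors form a subgroup \<open>\<Lambda>\<close>. It is discrete because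
  \<open>\<psi>\<close> is a homeomorphism and the orbit of \<open>\<psi> 0\<close> is discrete; it
  spans because a nonzero functional vanishing on it would be bounded by its values on the preimage
  of \<open>K\<close>. The conclusion compares orbits, since these are the fibres of the quotient
  map.\<close>

lemma conjugate_to_lattice:
  obtains \<psi> \<psi>' :: "'v \<Rightarrow> 'v" and B where "homeomorphism UNIV UNIV \<psi> \<psi>'"
    "finite B" "independent B" "span B = UNIV"
    "\<And>x y. (\<exists>T \<in> \<Gamma>. \<psi> y = T (\<psi> x)) \<longleftrightarrow> (\<exists>c::'v \<Rightarrow> int. y - x = (\<Sum>b\<in>B. of_int (c b) *\<^sub>R b))"
proof -
  obtain \<psi> \<psi>' :: "'v \<Rightarrow> 'v" where \<psi>: "homeomorphism UNIV UNIV \<psi> \<psi>'"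
    and equi: "\<And>T. T \<in> \<Gamma> \<Longrightarrow> \<exists>l. \<forall>x. T (\<psi> x) = \<psi> (x + l)"
    using affine_exponential by blast
  have inv: "\<psi>' (\<psi> x) = x" "\<psi> (\<psi>' x) = x" for x using \<psi> by (auto simp: homeomorphism_def)
  have inj: "\<psi> x = \<psi> y \<longleftrightarrow> x = y" for x y using inv by metis
  define \<Lambda> where "\<Lambda> = {l. \<exists>T \<in> \<Gamma>. \<forall>x. T (\<psi> x) = \<psi> (x + l)}"
  have orbit: "(\<exists>T \<in> \<Gamma>. \<psi> y = T (\<psi> x)) \<longleftrightarrow> y - x \<in> \<Lambda>" for x y
  proof
    assume "\<exists>T \<in> \<Gamma>. \<psi> y = T (\<psi> x)"
    then obtain T l where T: "T \<in> \<Gamma>" "\<psi> y = T (\<psi> x)" "\<forall>x. T (\<psi> x) = \<psi> (x + l)" using equi by blast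
    then have "y = x + l" using inj by metis
    then show "y - x \<in> \<Lambda>" using T by (auto simp: \<Lambda>_def)
  next
    assume "y - x \<in> \<Lambda>"
    then obtain T where "T \<in> \<Gamma>" "\<forall>z. T (\<psi> z) = \<psi> (z + (y - x))" by (auto simp: \<Lambda>_def)
    then show "\<exists>T \<in> \<Gamma>. \<psi> y = T (\<psi> x)" by (intro bexI[of _ T]) auto
  qed
  have diff: "k - l \<in> \<Lambda>" if kl: "k \<in> \<Lambda>" "l \<in> \<Lambda>" for k l
  proof -
    obtain S T where S: "S \<in> \<Gamma>" "\<forall>x. S (\<psi> x) = \<psi> (x + k)" and T: "T \<in> \<Gamma>" "\<forall>x. T (\<psi> x) = \<psi> (x + l)"
      using kl by (auto simp: \<Lambda>_def)
    have T': "bij T" "inv T \<in> \<Gamma>" using inverse[OF T(1)] by auto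
    have "inv T (\<psi> x) = \<psi> (x - l)" for x
      using T(2)[rule_format, of "x - l"] T'(1) by (metis bij_inv_eq_iff diff_add_cancel)
    then have "(S \<circ> inv T) (\<psi> x) = \<psi> (x + (k - l))" for x using S by (simp add: algebra_simps)
    then show ?thesis unfolding \<Lambda>_def mem_Collect_eq using compose[OF S(1) T'(2)] by blast
  qed
  obtain T0 where "T0 \<in> \<Gamma>" using nonempty by blast
  then have "\<Lambda> \<noteq> {}" using equi[of T0] unfolding \<Lambda>_def by blast
  then have zero: "0 \<in> \<Lambda>" using diff by (metis diff_self ex_in_conv)
  have cont: "continuous_on A \<psi>" "continuous_on A \<psi>'" for A
    using \<psi> by (auto simp: homeomorphism_def intro: continuous_on_subset)
  have fin: "finite (\<Lambda> \<inter> cball 0 r)" for r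
  proof -
    have "\<psi> ` (\<Lambda> \<inter> cball 0 r) \<subseteq> (\<lambda>T. T (\<psi> 0)) ` \<Gamma> \<inter> \<psi> ` cball 0 r"
      unfolding \<Lambda>_def by (auto simp: image_iff) (metis add_0)
    moreover have "finite ((\<lambda>T. T (\<psi> 0)) ` \<Gamma> \<inter> \<psi> ` cball 0 r)"
      by (intro discrete compact_continuous_image cont compact_cball)
    ultimately have "finite (\<psi> ` (\<Lambda> \<inter> cball 0 r))" by (rule finite_subset)
    then show ?thesis by (rule finite_imageD) (auto simp: inj_on_def inj)
  qed
  obtain K where K: "compact K" "\<And>x. \<exists>T \<in> \<Gamma>. \<exists>y \<in> K. x = T y" using cocompact by blast
  have "compact (\<psi>' ` K)" using K(1) cont by (intro compact_continuous_image)
  then obtain b where b: "\<And>y. y \<in> K \<Longrightarrow> norm (\<psi>' y) \<le> b"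
    using compact_imp_bounded[of "\<psi>' ` K"] unfolding bounded_iff by auto
  have span: "span \<Lambda> = UNIV"
  proof (rule ccontr)
    assume "span \<Lambda> \<noteq> UNIV"
    then have "dim \<Lambda> < DIM('v)" using dim_eq_full[of \<Lambda>] dim_subset_UNIV[of \<Lambda>] by linarith
    then obtain f where f: "f \<noteq> 0" "\<And>y. y \<in> span \<Lambda> \<Longrightarrow> orthogonal f y"
      using orthogonal_to_subspace_exists by metis
    \<comment> \<open>A value that exceeds by one the bound of the functional on the preimage of
      \<open>K\<close>.\<close>
    define s where "s = norm f * b + 1"
    obtain T y where Ty: "T \<in> \<Gamma>" "y \<in> K" "\<psi> ((s / (f \<bullet> f)) *\<^sub>R f) = T y" using K(2) by blast
    then have "(s / (f \<bullet> f)) *\<^sub>R f - \<psi>' y \<in> \<Lambda>" using orbit[of _ "\<psi>' y"] inv by auto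
    then have "f \<bullet> ((s / (f \<bullet> f)) *\<^sub>R f - \<psi>' y) = 0" using f(2) span_base by (auto simp: orthogonal_def)
    then have "s = f \<bullet> \<psi>' y" using f(1) by (simp add: inner_diff_right)
    also have "\<dots> \<le> norm f * norm (\<psi>' y)" by (rule norm_cauchy_schwarz)
    also have "\<dots> \<le> norm f * b" using b[OF Ty(2)] by (intro mult_left_mono) auto
    finally show False by (simp add: s_def)
  qed
  obtain B where B: "finite B" "independent B" "B \<subseteq> \<Lambda>" "span B = UNIV"
    "\<And>x. x \<in> \<Lambda> \<Longrightarrow> \<exists>c::'v \<Rightarrow> int. x = (\<Sum>b\<in>B. of_int (c b) *\<^sub>R b)"
    using lattice_basis[OF zero diff fin span] by blast
  have "x \<in> \<Lambda> \<longleftrightarrow> (\<exists>c::'v \<Rightarrow> int. x = (\<Sum>b\<in>B. of_int (c b) *\<^sub>R b))" for x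
    using B(5) subgroup_int_comb[OF zero diff B(1,3)] by blast
  then show thesis using that[OF \<psi> B(1,2,4)] orbit by simp
qed

end

section \<open>Quotients by lattices and the torus\<close>

lemma quotient_homeomorphic_torus:
  fixes q :: "real^'n::finite \<Rightarrow> 'a"
  assumes q: "continuous_map euclidean M q" "open_map euclidean M q" "range q = topspace M"
    and M: "compact_space M"
    and fibres: "\<And>x y. q x = q y \<longleftrightarrow> (\<forall>i. y $ i - x $ i \<in> \<int>)"
  shows "M homeomorphic_space (torus :: ('n \<Rightarrow> complex) topology)"
proof -
  define e :: "real^'n \<Rightarrow> 'n \<Rightarrow> complex" where "e x = (\<lambda>i. cis (2 * pi * x $ i))" for x
  have e: "continuous_map euclidean torus e"
    unfolding torus_def continuous_map_componentwise_UNIV e_def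
    by (auto simp: continuous_map_in_subtopology intro!: continuous_intros)
  have cis_eq: "cis (2 * pi * a) = cis (2 * pi * b) \<longleftrightarrow> b - a \<in> \<int>" for a b
  proof -
    have "cis (2 * pi * a) = cis (2 * pi * b) \<longleftrightarrow> cis (2 * pi * (b - a)) = 1"
      by (simp add: right_diff_distrib flip: cis_divide) (metis)
    also have "\<dots> \<longleftrightarrow> b - a \<in> \<int>"
      by (simp add: cis_conv_exp exp_eq_1 Ints_def image_iff)
    finally show ?thesis .
  qed
  have e_eq: "e x = e y \<longleftrightarrow> q x = q y" for x y
    by (simp add: e_def fun_eq_iff fibres cis_eq)
  have quot: "quotient_map euclidean M q"
    using q by (intro continuous_open_imp_quotient_map) auto
  \<comment> \<open>\<open>e\<close> and the quotient map \<open>q\<close> have the same fibres, so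
    \<open>e\<close> descends to a continuous bijection from the compact \<open>M\<close> to the
    Hausdorff torus.\<close>
  obtain g where g: "continuous_map M torus g" "g ` topspace M = e ` topspace euclidean"
    "\<And>x. x \<in> topspace euclidean \<Longrightarrow> g (q x) = e x"
    using quotient_map_lift_exists[OF quot e e_eq[THEN iffD2]] by blast
  have surj: "e ` UNIV = topspace torus"
  proof
    show "e ` UNIV \<subseteq> topspace torus" using continuous_map_image_subset_topspace[OF e] by simp
    show "topspace torus \<subseteq> e ` UNIV"
    proof
      fix z :: "'n \<Rightarrow> complex" assume "z \<in> topspace torus"
      then have "norm (z i) = 1" for i by (auto simp: torus_def PiE_def)
      then have "cis (Arg (z i)) = z i" for i
        using cis_Arg[of "z i"] by (metis div_by_1 norm_zero of_real_1 sgn_eq zero_neq_one)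
      then have "e (\<chi> i. Arg (z i) / (2 * pi)) = z"
        by (simp add: e_def fun_eq_iff)
      then show "z \<in> e ` UNIV" by (metis rangeI)
    qed
  qed
  have "homeomorphic_map M torus g"
  proof (rule continuous_imp_homeomorphic_map[OF g(1) M])
    show "Hausdorff_space (torus :: ('n \<Rightarrow> complex) topology)"
      unfolding torus_def by (simp add: Hausdorff_space_product_topology Hausdorff_space_subtopology)
    show "g ` topspace M = topspace torus" using g(2) surj by simp
    show "inj_on g (topspace M)"
      unfolding q(3)[symmetric] using g(3) e_eq by (auto simp: inj_on_def)
  qed
  then show ?thesis by (rule homeomorphic_map_imp_homeomorphic_space)
qed

text \<open>Coordinates in a lattice basis followed by the conjugation \<open>\<psi>\<close> give a
  bijection \<open>\<theta>\<close>, open by invariance of domain, for which the fibres of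
  \<open>q \<circ> \<theta>\<close> are the cosets of the integer vectors.\<close>

theorem crystallographic_quotient_torus:
  fixes q :: "real^'n::finite \<Rightarrow> 'a"
  assumes \<Gamma>: "crystallographic_action \<Gamma>"
    and q: "continuous_map euclidean M q" "open_map euclidean M q" "range q = topspace M"
    and M: "compact_space M"
    and fibres: "\<And>x y. q x = q y \<longleftrightarrow> (\<exists>T \<in> \<Gamma>. y = T x)"
  shows "M homeomorphic_space (torus :: ('n \<Rightarrow> complex) topology)"
proof -
  obtain \<psi> \<psi>' :: "real^'n \<Rightarrow> real^'n" and B where \<psi>: "homeomorphism UNIV UNIV \<psi> \<psi>'"
    and B: "finite B" "independent B" "span B = UNIV"
    and orbit: "\<And>x y. (\<exists>T \<in> \<Gamma>. \<psi> y = T (\<psi> x)) \<longleftrightarrow> (\<exists>c::real^'n \<Rightarrow> int. y - x = (\<Sum>b\<in>B. of_int (c b) *\<^sub>R b))"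
    using crystallographic_action.conjugate_to_lattice[OF \<Gamma>] by blast
  have "card B = CARD('n)" using B by (metis dim_eq_card_independent dim_span dim_UNIV DIM_cart DIM_real mult.right_neutral)
  then obtain \<beta> :: "'n \<Rightarrow> real^'n" where \<beta>: "bij_betw \<beta> UNIV B"
    using finite_same_card_bij[of "UNIV :: 'n set" B] B(1) by auto
  define A where "A x = (\<Sum>i\<in>UNIV. x $ i *\<^sub>R \<beta> i)" for x
  have A: "linear A" unfolding A_def by (intro linearI) (simp_all add: scaleR_add_left sum.distrib scaleR_sum_right)
  have sumB: "(\<Sum>b\<in>B. f b) = (\<Sum>i\<in>UNIV. f (\<beta> i))" for f :: "real^'n \<Rightarrow> real^'n"
    using sum.reindex_bij_betw[OF \<beta>, of f] by simp
  have "surj A"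
  proof (rule surjI)
    fix x
    have "x = (\<Sum>b\<in>B. representation B x b *\<^sub>R b)"
      using sum_representation_eq[OF B(2) _ B(1) order_refl] B(3) by simp
    then show "A (\<chi> i. representation B x (\<beta> i)) = x" by (simp add: A_def sumB)
  qed
  then have injA: "inj A" using A by (rule linear_surj_imp_inj[rotated])
  have contA: "continuous_on UNIV A" using A by (simp add: linear_continuous_on linear_conv_bounded_linear)
  have cont\<psi>: "continuous_on UNIV \<psi>" "inj \<psi>" "surj \<psi>"
    using \<psi> by (auto simp: homeomorphism_def inj_on_def) metis+
  define \<theta> where "\<theta> = \<psi> \<circ> A"
  have \<theta>: "continuous_on UNIV \<theta>" "inj \<theta>" "surj \<theta>"
    unfolding \<theta>_def using contA cont\<psi> injA \<open>surj A\<close>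
    by (blast intro: continuous_on_compose continuous_on_subset inj_compose, blast intro: inj_compose, metis comp_surj)
  show ?thesis
  proof (rule quotient_homeomorphic_torus[OF _ _ _ M])
    have c\<theta>: "continuous_map euclidean euclidean \<theta>" using \<theta>(1) by simp
    show "continuous_map euclidean M (q \<circ> \<theta>)" by (rule continuous_map_compose[OF c\<theta> q(1)])
    have "open_map euclidean euclidean \<theta>"
      unfolding open_map_def using invariance_of_domain[OF continuous_on_subset[OF \<theta>(1)] _ inj_on_subset[OF \<theta>(2)]] by auto
    then show "open_map euclidean M (q \<circ> \<theta>)" using q(2) by (rule open_map_compose)
    show "range (q \<circ> \<theta>) = topspace M" using \<theta>(3) q(3) by (metis image_comp)
    show "(q \<circ> \<theta>) x = (q \<circ> \<theta>) y \<longleftrightarrow> (\<forall>i. y $ i - x $ i \<in> \<int>)" for x y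
    proof -
      have "(q \<circ> \<theta>) x = (q \<circ> \<theta>) y \<longleftrightarrow> (\<exists>c::real^'n \<Rightarrow> int. A (y - x) = (\<Sum>b\<in>B. of_int (c b) *\<^sub>R b))"
        using orbit[of "A y" "A x"] by (simp add: \<theta>_def fibres linear_diff[OF A])
      also have "\<dots> \<longleftrightarrow> (\<exists>c::real^'n \<Rightarrow> int. A (y - x) = A (\<chi> i. of_int (c (\<beta> i))))"
        by (simp add: sumB A_def)
      also have "\<dots> \<longleftrightarrow> (\<exists>c::real^'n \<Rightarrow> int. \<forall>i. y $ i - x $ i = of_int (c (\<beta> i)))"
        by (simp only: inj_eq[OF injA]) (simp add: vec_eq_iff)
      also have "\<dots> \<longleftrightarrow> (\<forall>i. y $ i - x $ i \<in> \<int>)"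
      proof
        assume Z: "\<forall>i. y $ i - x $ i \<in> \<int>"
        \<comment> \<open>The integer coefficients are indexed by basis vectors rather than
          coordinates, so \<open>inv \<beta>\<close> recovers the coordinate from the
          vector.\<close>
        have H: "y $ i - x $ i = of_int \<lfloor>(y - x) $ inv \<beta> (\<beta> i)\<rfloor>" for i
          using Z \<beta> by (simp add: bij_betw_def inv_f_f)
        show "\<exists>c::real^'n \<Rightarrow> int. \<forall>i. y $ i - x $ i = of_int (c (\<beta> i))"
          by (rule exI[of _ "\<lambda>b. \<lfloor>(y - x) $ inv \<beta> b\<rfloor>"]) (rule allI, rule H)
      qed auto
      finally show ?thesis .
    qed
  qed
qed

section \<open>Developing maps of complete affine manifolds\<close>

lemma affine_transformationsE:
  assumes "T \<in> affine_transformations"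
  obtains L b where "linear L" "bij L" "T = (\<lambda>x. L x + b)"
  using assms by (auto simp: affine_transformations_def)

lemma affine_transformation_linear_part:
  assumes "T \<in> affine_transformations"
  shows "linear (linear_part T)" "T x - T y = linear_part T (x - y)"
proof -
  obtain L b where L: "linear L" "bij L" "T = (\<lambda>x. L x + b)" by (rule affine_transformationsE[OF assms])
  then have "linear_part T = L" by (auto simp: linear_part_def linear_0)
  then show "linear (linear_part T)" "T x - T y = linear_part T (x - y)"
    using L by (simp_all add: linear_diff)
qed

lemma affine_transformation_bij: "T \<in> affine_transformations \<Longrightarrow> bij T"
proof -
  assume "T \<in> affine_transformations"
  then obtain L b where L: "linear L" "bij L" "T = (\<lambda>x. L x + b)" by (rule affine_transformationsE)
  have "T = (\<lambda>x. x + b) \<circ> L" using L by auto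
  then show "bij T" using L(2) bij_plus_right[of b] by (simp add: bij_comp)
qed

lemma affine_transformation_compose:
  assumes "S \<in> affine_transformations" "T \<in> affine_transformations"
  shows "S \<circ> T \<in> affine_transformations"
proof -
  obtain L b where L: "linear L" "bij L" "S = (\<lambda>x. L x + b)" by (rule affine_transformationsE[OF assms(1)])
  obtain K c where K: "linear K" "bij K" "T = (\<lambda>x. K x + c)" by (rule affine_transformationsE[OF assms(2)])
  have "linear (L \<circ> K)" using K(1) L(1) by (rule linear_compose)
  moreover have "bij (L \<circ> K)" using K(2) L(2) by (rule bij_comp)
  moreover have "S \<circ> T = (\<lambda>x. (L \<circ> K) x + (L c + b))"
    using L K by (auto simp: linear_add)
  ultimately show ?thesis unfolding affine_transformations_def by blast
qed

lemma affine_transformation_inv: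
  assumes "T \<in> affine_transformations"
  shows "inv T \<in> affine_transformations"
proof -
  obtain L b where L: "linear L" "bij L" "T = (\<lambda>x. L x + b)" by (rule affine_transformationsE[OF assms])
  have lin: "linear (inv L)"
    using L(1,2) by (metis bij_is_inj bij_is_surj inj_linear_imp_inv_linear)
  have "inv T = (\<lambda>x. inv L x + inv L (- b))"
  proof
    fix x
    have "T (inv L x + inv L (- b)) = x"
      using L by (simp add: linear_add bij_is_surj surj_f_inv_f)
    then show "inv T x = inv L x + inv L (- b)"
      using affine_transformation_bij[OF assms] by (metis bij_inv_eq_iff)
  qed
  then show ?thesis
    using lin bij_imp_bij_inv[OF L(2)] unfolding affine_transformations_def by blast
qed

lemma affine_transformation_id: "id \<in> affine_transformations"
  unfolding affine_transformations_def
  by (rule CollectI, rule exI[of _ id], rule exI[of _ 0]) (auto simp: linear_id)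

lemma affine_transformation_continuous_on:
  assumes "T \<in> affine_transformations" shows "continuous_on A T"
proof -
  obtain L b where L: "linear L" "bij L" "T = (\<lambda>x. L x + b)" by (rule affine_transformationsE[OF assms])
  have "continuous_on A (\<lambda>x. L x + b)"
    using L(1) by (intro continuous_on_add continuous_on_const linear_continuous_on)
      (simp add: linear_conv_bounded_linear)
  then show ?thesis by (simp only: L(3))
qed

lemma affine_transformation_open_image:
  assumes "T \<in> affine_transformations" "open S" shows "open (T ` S)"
proof -
  have b: "bij T" using affine_transformation_bij[OF assms(1)] .
  have "T ` S = inv T -` S" using b by (simp add: bij_vimage_eq_inv_image bij_imp_bij_inv inv_inv_eq)
  then show ?thesis
    using open_vimage[OF assms(2) affine_transformation_continuous_on[OF affine_transformation_inv[OF assms(1)]]] by simp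
qed

text \<open>A small positive multiple of \<open>z - x\<close> keeps the point inside
  \<open>N\<close>, and linearity scales the agreement there back to \<open>z\<close>.\<close>

lemma affine_transformation_eq_on_open:
  assumes ST: "S \<in> affine_transformations" "T \<in> affine_transformations"
    and O: "open N" "x \<in> N" and eq: "\<And>y. y \<in> N \<Longrightarrow> S y = T y"
  shows "S = T"
proof
  fix z
  obtain e where e: "e > 0" "ball x e \<subseteq> N" using O open_contains_ball by blast
  \<comment> \<open>The added 1 keeps the denominator positive when \<open>z = x\<close>.\<close>
  define r where "r = e / (2 * (norm (z - x) + 1))"
  have r: "r > 0" using e(1) by (simp add: r_def add_nonneg_pos)
  have "r * norm (z - x) < e"
    using e(1) by (simp add: r_def field_simps add_nonneg_pos add_pos_nonneg)
  then have "x + r *\<^sub>R (z - x) \<in> N" using e r by (auto simp: dist_norm subset_iff)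
  then have "S (x + r *\<^sub>R (z - x)) - S x = T (x + r *\<^sub>R (z - x)) - T x" using eq O(2) by simp
  then have "r *\<^sub>R (S z - S x) = r *\<^sub>R (T z - T x)"
    using affine_transformation_linear_part[OF ST(1)] affine_transformation_linear_part[OF ST(2)]
    by (simp add: linear_scale)
  then show "S z = T z" using r eq[OF O(2)] by simp
qed

text \<open>Two affine formulas that agree at two distinct parameters are equal, so the formula
  valid near 0 passes from each neighbourhood to the next.\<close>

lemma locally_affine_imp_affine:
  fixes h :: "real \<Rightarrow> 'v::real_vector"
  assumes loc: "\<And>t. t \<in> {0..1} \<Longrightarrow> \<exists>a u S. open S \<and> t \<in> S \<and> (\<forall>s \<in> S \<inter> {0..1}. h s = a + s *\<^sub>R u)"
    and init: "open S0" "0 \<in> S0" "\<And>s. s \<in> S0 \<inter> {0..1} \<Longrightarrow> h s = a0 + s *\<^sub>R u0"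
    and r: "r \<in> {0..1}"
  shows "h r = a0 + r *\<^sub>R u0"
proof -
  define near where "near t \<longleftrightarrow> (\<exists>S. open S \<and> t \<in> S \<and> (\<forall>s \<in> S \<inter> {0..1}. h s = a0 + s *\<^sub>R u0))" for t
  define P where "P a b \<longleftrightarrow> (0 \<le> a \<and> a \<le> b \<and> b \<le> 1 \<longrightarrow> near a \<longrightarrow> near b)" for a b
  have "P 0 r"
  proof (rule Bolzano)
    show "0 \<le> r" using r by simp
    show "P a c" if "P a b" "P b c" "a \<le> b" "b \<le> c" for a b c
      using that unfolding P_def by auto
  next
    fix t :: real assume t: "0 \<le> t" "t \<le> r"
    then obtain a u S where S: "open S" "t \<in> S" "\<And>s. s \<in> S \<inter> {0..1} \<Longrightarrow> h s = a + s *\<^sub>R u"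
      using loc[of t] r by force
    obtain d where d: "d > 0" "ball t d \<subseteq> S" using S open_contains_ball by blast
    show "\<exists>d>0. \<forall>a b. a \<le> t \<and> t \<le> b \<and> b - a < d \<longrightarrow> P a b"
    proof (intro exI[of _ d] conjI allI impI d(1))
      fix x y assume xy: "x \<le> t \<and> t \<le> y \<and> y - x < d"
      show "P x y" unfolding P_def
      proof (intro impI)
        assume 0: "0 \<le> x \<and> x \<le> y \<and> y \<le> 1" and "near x"
        then obtain S' where S': "open S'" "x \<in> S'" "\<And>s. s \<in> S' \<inter> {0..1} \<Longrightarrow> h s = a0 + s *\<^sub>R u0"
          unfolding near_def by blast
        have xS: "x \<in> S" "y \<in> S" using d xy by (auto simp: dist_real_def subset_iff)
        then obtain e where e: "e > 0" "ball x e \<subseteq> S \<inter> S'"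
          using S(1) S'(1,2) by (metis IntI open_Int open_contains_ball)
        \<comment> \<open>A second parameter in the overlap, to the right of \<open>x\<close>, or to
          its left when \<open>x = 1\<close>, clipped so as to stay in
          \<open>{0..1}\<close>.\<close>
        define s where "s = (if x < 1 then x + min (e / 2) (1 - x) else x - min (e / 2) x)"
        have s: "s \<in> S \<inter> S'" "s \<in> {0..1}" "s \<noteq> x"
          using e 0 by (auto simp: s_def dist_real_def subset_iff)
        have eqs: "a + s *\<^sub>R u = a0 + s *\<^sub>R u0" "a + x *\<^sub>R u = a0 + x *\<^sub>R u0"
          using S(3)[of s] S'(3)[of s] S(3)[of x] S'(3)[of x] s xS S'(2) 0 by auto
        have "(s - x) *\<^sub>R u = (a + s *\<^sub>R u) - (a + x *\<^sub>R u)" by (simp add: algebra_simps)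
        also have "\<dots> = (s - x) *\<^sub>R u0" unfolding eqs by (simp add: algebra_simps)
        finally have "u = u0" using s(3) by simp
        then have "a = a0" using eqs by simp
        then show "near y" unfolding near_def using S xS \<open>u = u0\<close> by blast
      qed
    qed
  qed
  moreover have "near 0" unfolding near_def using init by blast
  ultimately have "near r" using r by (simp add: P_def)
  then show ?thesis using r by (auto simp: near_def)
qed

text \<open>Constant loops at two points are freely homotopic, and the track of the base point is a
  path between them.\<close>

lemma simply_connected_imp_connected_space:
  assumes "simply_connected_space X" shows "connected_space X"
proof (rule path_connected_imp_connected_space, unfold path_connected_space_def, intro ballI)
  fix x y assume xy: "x \<in> topspace X" "y \<in> topspace X"
  then have "homotopic_with (\<lambda>r. r 1 = r 0) (top_of_set {0..1::real}) X (\<lambda>_. x) (\<lambda>_. y)"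
    using assms unfolding simply_connected_space_def pathin_def by simp
  then obtain h where h: "continuous_map (top_of_set ({0..1::real} \<times> {0..1::real})) X h"
    "\<And>t. h (0, t) = x" "\<And>t. h (1, t) = y"
    unfolding homotopic_with_def by auto
  have "continuous_map (top_of_set {0..1::real}) (top_of_set ({0..1::real} \<times> {0..1::real})) (\<lambda>s. (s, 0))"
    by (auto intro!: continuous_intros)
  from continuous_map_compose[OF this h(1)] h(2,3)
  show "\<exists>g. pathin X g \<and> g 0 = x \<and> g 1 = y"
    unfolding pathin_def o_def by (intro exI[of _ "\<lambda>s. h (s, 0)"]) auto
qed

locale complete_affine_manifold =
  fixes M :: "'a topology" and \<A> :: "('a, 'n::finite) chart set"
    and C :: "'b topology" and p :: "'b \<Rightarrow> 'a" and D :: "'b \<Rightarrow> real^'n"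
  assumes charts: "\<And>c. c \<in> \<A> \<Longrightarrow> chart_of M c"
    and charts_cover: "(\<Union>c \<in> \<A>. fst c) = topspace M"
    and Hausdorff: "Hausdorff_space M"
    and nonempty: "topspace M \<noteq> {}"
    and complete: "geodesically_complete M \<A>"
    and cover: "universal_cover C p M"
    and developing: "developing_map \<A> C p D"
begin

lemma covering: "covering_map C p M"
  using cover by (simp add: universal_cover_def)

lemma p_local_homeomorphism: "local_homeomorphism C M p"
  by (rule covering_map_imp_local_homeomorphism[OF covering])

lemma p_cont: "continuous_map C M p"
  using covering by (simp add: covering_map_def)

lemma p_surj: "p ` topspace C = topspace M"
  using covering by (simp add: covering_map_def)

lemma C_connected: "connected_space C"
  using cover by (simp add: universal_cover_def simply_connected_imp_connected_space)

lemma C_Hausdorff: "Hausdorff_space C"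
  by (rule covering_map_Hausdorff[OF covering Hausdorff])

lemma chartD:
  assumes "(V, \<phi>) \<in> \<A>"
  shows "openin M V" "open (\<phi> ` V)" "homeomorphic_map (subtopology M V) (top_of_set (\<phi> ` V)) \<phi>" "inj_on \<phi> V"
proof -
  show 1: "openin M V" "open (\<phi> ` V)" "homeomorphic_map (subtopology M V) (top_of_set (\<phi> ` V)) \<phi>"
    using charts[OF assms] by (auto simp: chart_of_def)
  show "inj_on \<phi> V"
    using homeomorphic_imp_injective_map[OF 1(3)] openin_subset[OF 1(1)] by (simp add: Int_absorb1)
qed

lemma chart_at:
  assumes "m \<in> topspace M" obtains V \<phi> where "(V, \<phi>) \<in> \<A>" "m \<in> V"
  using assms charts_cover by (metis UN_E prod.collapse)

lemma developing_in_chart: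
  assumes "(V, \<phi>) \<in> \<A>" "x \<in> topspace C" "p x \<in> V"
  obtains T N where "T \<in> affine_transformations" "openin C N" "x \<in> N" "p ` N \<subseteq> V"
    "\<And>y. y \<in> N \<Longrightarrow> D y = T (\<phi> (p y))" "inj_on p N"
proof -
  obtain T N where T: "T \<in> affine_transformations" "openin C N" "x \<in> N" "p ` N \<subseteq> V"
    "\<forall>y \<in> N. D y = T (\<phi> (p y))"
    using developing assms unfolding developing_map_def by fast
  obtain W where W: "openin C W" "x \<in> W" "inj_on p W"
    using p_local_homeomorphism assms(2) unfolding local_homeomorphism_def by blast
  show thesis
    by (rule that[of T "N \<inter> W"]) (use T W in \<open>auto intro: inj_on_subset\<close>)
qed

text \<open>Near each point \<open>D\<close> is the composite of the local homeomorphism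
  \<open>p\<close>, a chart and an affine bijection; the three properties are checked there and then
  patched.\<close>

lemma D_local_homeomorphism: "local_homeomorphism C euclidean D"
proof -
  have loc: "\<exists>N. openin C N \<and> x \<in> N \<and> inj_on D N \<and> (\<forall>O'. openin C O' \<and> O' \<subseteq> N \<longrightarrow> open (D ` O'))
      \<and> continuous_map (subtopology C N) euclidean D" if x: "x \<in> topspace C" for x
  proof -
    have "p x \<in> topspace M" using p_surj x by blast
    then obtain V \<phi> where V: "(V, \<phi>) \<in> \<A>" "p x \<in> V" by (rule chart_at)
    obtain T N where T: "T \<in> affine_transformations" and N: "openin C N" "x \<in> N" "p ` N \<subseteq> V"
      and DT: "\<And>y. y \<in> N \<Longrightarrow> D y = T (\<phi> (p y))" and inj: "inj_on p N"
      using developing_in_chart[OF V(1) x V(2)] by metis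
    note chart = chartD[OF V(1)]
    have "inj_on D N"
    proof (rule inj_onI)
      fix y z assume "y \<in> N" "z \<in> N" "D y = D z"
      then have "\<phi> (p y) = \<phi> (p z)" using DT bij_is_inj[OF affine_transformation_bij[OF T]] by (simp add: inj_eq)
      then show "y = z" using chart(4) inj N(3) \<open>y \<in> N\<close> \<open>z \<in> N\<close> by (auto dest!: inj_onD)
    qed
    moreover have "open (D ` O')" if O': "openin C O'" "O' \<subseteq> N" for O'
    proof -
      have "openin M (p ` O')" using p_local_homeomorphism O' unfolding local_homeomorphism_def open_map_def by blast
      then have "openin (subtopology M V) (p ` O')"
        using O'(2) N(3) chart(1) by (subst openin_open_subtopology) auto
      then have "openin (top_of_set (\<phi> ` V)) (\<phi> ` p ` O')"
        using homeomorphic_imp_open_map[OF chart(3)] unfolding open_map_def by blast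
      then have "open (\<phi> ` p ` O')" using chart(2) by (rule openin_open_trans)
      then have "open (T ` \<phi> ` p ` O')" by (rule affine_transformation_open_image[OF T])
      also have "T ` \<phi> ` p ` O' = D ` O'" using DT O'(2) by (auto simp: image_image intro!: image_cong)
      finally show ?thesis .
    qed
    moreover have "continuous_map (subtopology C N) euclidean D"
    proof -
      have 1: "continuous_map (subtopology C N) (subtopology M V) p"
        using p_cont N(3) by (auto simp: continuous_map_in_subtopology continuous_map_from_subtopology)
      have "continuous_map (subtopology M V) euclidean \<phi>"
        using homeomorphic_imp_continuous_map[OF chart(3)] by (simp add: continuous_map_in_subtopology)
      from continuous_map_compose[OF 1 this]
      have 2: "continuous_map (subtopology C N) euclidean (\<phi> \<circ> p)" .
      have "continuous_map euclidean euclidean T" using affine_transformation_continuous_on[OF T] by simp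
      from continuous_map_compose[OF 2 this] show ?thesis
        by (rule continuous_map_eq) (use DT in auto)
    qed
    ultimately show ?thesis using N by blast
  qed
  show ?thesis
    unfolding local_homeomorphism_def
  proof (intro conjI ballI)
    show "\<exists>W. openin C W \<and> y \<in> W \<and> inj_on D W" if y: "y \<in> topspace C" for y
      using loc[OF y] by blast
    show "open_map C euclidean D" unfolding open_map_def
    proof (intro allI impI)
      fix O' assume O': "openin C O'"
      have "\<exists>T. open T \<and> z \<in> T \<and> T \<subseteq> D ` O'" if z: "z \<in> D ` O'" for z
      proof -
        obtain x where x: "x \<in> O'" "z = D x" using z by blast
        then have xC: "x \<in> topspace C" using O' openin_subset by blast
        obtain N where N: "openin C N" "x \<in> N" "\<And>O'. openin C O' \<Longrightarrow> O' \<subseteq> N \<Longrightarrow> open (D ` O')"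
          using loc[OF xC] by blast
        have "open (D ` (O' \<inter> N))" using O' N by blast
        then show ?thesis using x N by blast
      qed
      then show "openin euclidean (D ` O')" by (subst open_openin[symmetric], subst open_subopen) blast
    qed
    show "continuous_map C euclidean D" unfolding continuous_map
    proof (intro conjI allI impI)
      fix O' :: "(real^'n) set" assume O': "openin euclidean O'"
      show "openin C {x \<in> topspace C. D x \<in> O'}"
      proof (subst openin_subopen, intro ballI)
        fix x assume x: "x \<in> {x \<in> topspace C. D x \<in> O'}"
        then have xC: "x \<in> topspace C" by simp
        obtain N where N: "openin C N" "x \<in> N" "continuous_map (subtopology C N) euclidean D"
          using loc[OF xC] by blast
        have "openin (subtopology C N) {y \<in> topspace (subtopology C N). D y \<in> O'}"
          by (rule openin_continuous_map_preimage[OF N(3) O'])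
        then have "openin C {y \<in> topspace (subtopology C N). D y \<in> O'}"
          using N(1) by (rule openin_trans_full)
        then show "\<exists>T. openin C T \<and> x \<in> T \<and> T \<subseteq> {x \<in> topspace C. D x \<in> O'}"
          using x N by (intro exI[of _ "{y \<in> topspace (subtopology C N). D y \<in> O'}"]) auto
      qed
    qed simp
  qed
qed

text \<open>This is where completeness is used. A geodesic of \<open>M\<close> defined for all times
  is lifted to \<open>C\<close>; its development is locally affine, hence a straight segment, and
  the initial velocity can be prescribed.\<close>

lemma line_lifting:
  assumes x: "x \<in> topspace C"
  shows "\<exists>g. continuous_map (top_of_set {0..1}) C g \<and> g 0 = x \<and> (\<forall>t \<in> {0..1}. D (g t) = D x + t *\<^sub>R v)"
proof -
  have "p x \<in> topspace M" using p_surj x by blast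
  then obtain V \<phi> where V: "(V, \<phi>) \<in> \<A>" "p x \<in> V" by (rule chart_at)
  obtain T N where T: "T \<in> affine_transformations" and N: "openin C N" "x \<in> N" "p ` N \<subseteq> V"
    and DT: "\<And>y. y \<in> N \<Longrightarrow> D y = T (\<phi> (p y))"
    using developing_in_chart[OF V(1) x V(2)] by metis
  obtain L b where L: "linear L" "bij L" "T = (\<lambda>x. L x + b)" by (rule affine_transformationsE[OF T])
  \<comment> \<open>Near \<open>x\<close> the development is the chart followed by \<open>T\<close>,
    whose linear part is \<open>L\<close>; the chart velocity therefore has to be
    \<open>inv L v\<close>.\<close>
  define w where "w = inv L v"
  have Lw: "L w = v" using L(2) by (simp add: w_def bij_is_surj surj_f_inv_f)
  obtain c where c: "geodesic_line M \<A> c" "c 0 = p x" "((\<lambda>s. \<phi> (c s)) has_vector_derivative w) (at 0)"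
    using complete V unfolding geodesically_complete_def by fast
  have cc: "continuous_map (top_of_set {0..1}) M c"
    using c(1) unfolding geodesic_line_def by (auto intro: continuous_map_from_subtopology)
  obtain g where g: "continuous_map (top_of_set {0..1}) C g" "g 0 = x" "\<And>t. t \<in> {0..1} \<Longrightarrow> p (g t) = c t"
    using path_lifting[OF covering cc x] c(2) by metis
  have near: "\<exists>S. open S \<and> t \<in> S \<and> (\<forall>s \<in> S \<inter> {0..1}. D (g s) = T (a + s *\<^sub>R u))"
    if t: "t \<in> {0..1}" and T: "openin C N" "g t \<in> N" "\<And>y. y \<in> N \<Longrightarrow> D y = T (\<phi> (p y))"
      and ev: "\<forall>\<^sub>F s in nhds t. \<phi> (c s) = a + s *\<^sub>R u" for t T N \<phi> a u
  proof -
    have "openin (top_of_set {0..1}) {s \<in> topspace (top_of_set {0..1}). g s \<in> N}"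
      by (rule openin_continuous_map_preimage[OF g(1) T(1)])
    then obtain S1 where S1: "open S1" "{s \<in> topspace (top_of_set {0..1}). g s \<in> N} = {0..1} \<inter> S1"
      unfolding openin_open by blast
    obtain S2 where S2: "open S2" "t \<in> S2" "\<And>s. s \<in> S2 \<Longrightarrow> \<phi> (c s) = a + s *\<^sub>R u"
      using ev unfolding eventually_nhds by blast
    have "t \<in> {s \<in> topspace (top_of_set {0..1}). g s \<in> N}" using t T(2) by simp
    then have tS1: "t \<in> S1" unfolding S1(2) by blast
    have "D (g s) = T (a + s *\<^sub>R u)" if s: "s \<in> S1 \<inter> S2 \<inter> {0..1}" for s
    proof -
      have "s \<in> {s \<in> topspace (top_of_set {0..1}). g s \<in> N}" unfolding S1(2) using s by blast
      then have "g s \<in> N" by blast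
      from T(3)[OF this] show ?thesis using S2(3)[of s] g(3)[of s] s by simp
    qed
    then show ?thesis using S1(1) S2(1,2) tS1 by (intro exI[of _ "S1 \<inter> S2"] conjI ballI open_Int) blast+
  qed
  have loc: "\<exists>a u S. open S \<and> t \<in> S \<and> (\<forall>s \<in> S \<inter> {0..1}. D (g s) = a + s *\<^sub>R u)" if t: "t \<in> {0..1}" for t
  proof -
    have gt: "g t \<in> topspace C" using g(1) t continuous_map_image_subset_topspace by fastforce
    have "c t \<in> topspace M" using gt p_surj by (subst g(3)[OF t, symmetric]) blast
    then obtain V \<phi> where V: "(V, \<phi>) \<in> \<A>" "c t \<in> V" by (rule chart_at)
    have "p (g t) \<in> V" using V g(3)[OF t] by simp
    then obtain T N where T: "T \<in> affine_transformations" and N: "openin C N" "g t \<in> N"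
      and DT: "\<And>y. y \<in> N \<Longrightarrow> D y = T (\<phi> (p y))"
      using developing_in_chart[OF V(1) gt] by metis
    obtain a u where "\<forall>\<^sub>F s in nhds t. \<phi> (c s) = a + s *\<^sub>R u"
      using c(1) V unfolding geodesic_line_def by fast
    from near[OF t N DT this] obtain S where S: "open S" "t \<in> S" "\<forall>s \<in> S \<inter> {0..1}. D (g s) = T (a + s *\<^sub>R u)"
      by blast
    obtain L b where L: "linear L" "T = (\<lambda>x. L x + b)" using affine_transformationsE[OF T] by metis
    have "T (a + s *\<^sub>R u) = (L a + b) + s *\<^sub>R L u" for s using L by (simp add: linear_add linear_scale)
    then show ?thesis using S by metis
  qed
  obtain a u where ev: "\<forall>\<^sub>F s in nhds 0. \<phi> (c s) = a + s *\<^sub>R u"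
    using c(1,2) V unfolding geodesic_line_def by fastforce
  \<comment> \<open>\<open>u\<close> comes from the local form of the geodesic and \<open>w\<close>
    from its prescribed velocity; uniqueness of derivatives identifies them.\<close>
  have "((\<lambda>s. a + s *\<^sub>R u) has_vector_derivative u) (at 0)"
    by (auto intro!: derivative_eq_intros)
  moreover obtain S1 where "open S1" "0 \<in> S1" "\<And>s. s \<in> S1 \<Longrightarrow> \<phi> (c s) = a + s *\<^sub>R u"
    using ev unfolding eventually_nhds by blast
  from has_vector_derivative_transform_within_open[OF c(3) this]
  have "((\<lambda>s. a + s *\<^sub>R u) has_vector_derivative w) (at 0)" .
  ultimately have uw: "u = w" by (rule vector_derivative_unique_at)
  have gN: "g 0 \<in> N" using N g(2) by simp
  obtain S where S: "open S" "0 \<in> S" "\<forall>s \<in> S \<inter> {0..1}. D (g s) = T (a + s *\<^sub>R u)"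
    using near[OF _ N(1) gN DT ev] by auto
  have "D x = T a" using S(2,3) g(2) by force
  then have "D (g s) = D x + s *\<^sub>R v" if "s \<in> S \<inter> {0..1}" for s
    using S(3) that L Lw uw by (simp add: linear_add linear_scale)
  then have "D (g t) = D x + t *\<^sub>R v" if "t \<in> {0..1}" for t
    using locally_affine_imp_affine[OF loc S(1,2) _ that, of "D x" v] by blast
  then show ?thesis using g by blast
qed

text \<open>Lifting all segments that issue from one point \<open>D x0\<close> yields a section
  \<open>E\<close> of \<open>D\<close>: the value at \<open>y\<close> is the end of the lifted
  segment to \<open>y\<close>. Continuity of \<open>E\<close> is
  \<open>end_of_lift_continuous\<close>.\<close>

lemma developing_homeomorphism:
  obtains E where "homeomorphic_maps C euclidean D E"
proof -
  obtain x0 where x0: "x0 \<in> topspace C" using nonempty p_surj by blast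
  obtain G where G: "\<And>v. continuous_map (top_of_set {0..1}) C (G v)" "\<And>v. G v 0 = x0"
    "\<And>v t. t \<in> {0..1} \<Longrightarrow> D (G v t) = D x0 + t *\<^sub>R v"
    using line_lifting[OF x0] by metis
  have D_inj: "\<And>y. y \<in> topspace C \<Longrightarrow> \<exists>W. openin C W \<and> y \<in> W \<and> inj_on D W"
    using D_local_homeomorphism unfolding local_homeomorphism_def by blast
  have D_cont: "continuous_map C euclidean D"
    using D_local_homeomorphism unfolding local_homeomorphism_def by blast
  have "continuous_map (prod_topology euclidean (top_of_set {0..1})) euclidean (\<lambda>(v, t). D (G v t))"
  proof (rule continuous_map_eq)
    have "prod_topology (euclidean :: (real^'n) topology) (top_of_set {0..1::real}) = subtopology (prod_topology euclidean euclidean) (UNIV \<times> {0..1})"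
      by (simp only: subtopology_Times subtopology_UNIV)
    then have eq: "prod_topology (euclidean :: (real^'n) topology) (top_of_set {0..1::real}) = top_of_set (UNIV \<times> {0..1})"
      by (simp only: prod_topology_euclidean)
    show "continuous_map (prod_topology euclidean (top_of_set {0..1})) euclidean (\<lambda>z. D x0 + snd z *\<^sub>R fst z)"
      unfolding eq by (auto intro!: continuous_intros)
  qed (auto simp: G(3))
  then have cont: "continuous_map euclidean C (\<lambda>v. G v 1)"
  proof (rule end_of_lift_continuous[OF D_local_homeomorphism C_Hausdorff])
    show "continuous_map (top_of_set {0..1}) C (G v)" for v by (rule G(1))
    show "continuous_map euclidean C (\<lambda>v. G v 0)" using x0 by (simp add: G(2))
  qed
  define E where "E y = G (y - D x0) 1" for y
  have "continuous_map euclidean C ((\<lambda>v. G v 1) \<circ> (\<lambda>y. y - D x0))"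
    by (rule continuous_map_compose[OF _ cont]) (auto intro: continuous_intros)
  then have E_cont: "continuous_map euclidean C E" by (simp add: E_def[abs_def] o_def)
  have DE: "D (E y) = y" for y by (simp add: E_def G(3))
  have "G 0 1 = x0"
  proof (rule unique_lift[OF _ C_Hausdorff D_inj G(1), where g = "\<lambda>_. x0" and ?z0.0 = 0])
    show "connected_space (top_of_set {0..1::real})"
      by (simp add: connected_space_subtopology connectedin_subtopology flip: connectedin_topspace)
  qed (simp_all add: x0 G(2,3))
  then have E0: "E (D x0) = x0" by (simp add: E_def)
  \<comment> \<open>\<open>E \<circ> D\<close> and the identity are both lifts of \<open>D\<close>
    along \<open>D\<close>, agree at \<open>x0\<close>, and live on the connected space
    \<open>C\<close>.\<close>
  have "(E \<circ> D) x = id x" if x: "x \<in> topspace C" for x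
  proof (rule unique_lift[OF C_connected C_Hausdorff D_inj, where f = "E \<circ> D" and g = id and ?z0.0 = x0])
    show "continuous_map C C (E \<circ> D)" using D_cont E_cont by (rule continuous_map_compose)
  qed (simp_all add: x x0 DE E0)
  then have "homeomorphic_maps C euclidean D E"
    using D_cont E_cont DE by (simp add: homeomorphic_maps_def)
  then show thesis by (rule that)
qed

end

section \<open>The deck group and the leaves\<close>

locale developed_affine_manifold = complete_affine_manifold M \<A> C p D
  for M :: "'a topology" and \<A> :: "('a, 'n::finite) chart set"
    and C :: "'b topology" and p :: "'b \<Rightarrow> 'a" and D :: "'b \<Rightarrow> real^'n" +
  fixes E :: "real^'n \<Rightarrow> 'b"
  assumes E: "homeomorphic_maps C euclidean D E"
begin

definition \<pi> :: "real^'n \<Rightarrow> 'a" where "\<pi> x = p (E x)"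

text \<open>The group \<open>\<Gamma>\<close> of the overview, taken directly as affine maps of the
  model space over \<open>M\<close>. The lemma \<open>holonomy_eq\<close> returns to the given data:
  each such map is the holonomy of the deck transformation obtained by conjugating with
  \<open>D\<close>, so invariance of \<open>U\<close> applies to it.\<close>

definition deck :: "(real^'n \<Rightarrow> real^'n) set" where
  "deck = {T \<in> affine_transformations. \<forall>x. \<pi> (T x) = \<pi> x}"

lemma DE: "D (E x) = x" and E_in: "E x \<in> topspace C" and ED: "y \<in> topspace C \<Longrightarrow> E (D y) = y"
  using E by (auto simp: homeomorphic_maps_def continuous_map_def)

lemma E_cont: "continuous_map euclidean C E" and D_cont: "continuous_map C euclidean D"
  using E by (auto simp: homeomorphic_maps_def)

lemma \<pi>_cont: "continuous_map euclidean M \<pi>"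
  using continuous_map_compose[OF E_cont p_cont] by (simp add: \<pi>_def[abs_def] o_def)

lemma \<pi>_in: "\<pi> x \<in> topspace M"
  using p_surj E_in by (auto simp: \<pi>_def)

lemma \<pi>_D: "y \<in> topspace C \<Longrightarrow> \<pi> (D y) = p y"
  by (simp add: \<pi>_def ED)

lemma \<pi>_surj: "range \<pi> = topspace M"
proof
  show "range \<pi> \<subseteq> topspace M" using \<pi>_in by blast
  show "topspace M \<subseteq> range \<pi>"
    using p_surj \<pi>_D by (metis image_subset_iff rangeI)
qed

lemma \<pi>_open: "open_map euclidean M \<pi>"
proof -
  have "homeomorphic_map euclidean C E" using E homeomorphic_maps_map homeomorphic_maps_sym by metis
  then have "open_map euclidean C E" by (rule homeomorphic_imp_open_map)
  moreover have "open_map C M p" using p_local_homeomorphism by (simp add: local_homeomorphism_def)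
  ultimately have "open_map euclidean M (p \<circ> E)" by (rule open_map_compose)
  then show ?thesis by (simp add: \<pi>_def[abs_def] o_def)
qed

lemma \<pi>_locally_injective:
  obtains N where "open N" "x \<in> N" "inj_on \<pi> N"
proof -
  obtain W where W: "openin C W" "E x \<in> W" "inj_on p W"
    using p_local_homeomorphism E_in unfolding local_homeomorphism_def by blast
  have "openin euclidean {y \<in> topspace euclidean. E y \<in> W}"
    by (rule openin_continuous_map_preimage[OF E_cont W(1)])
  then have "open {y. E y \<in> W}" by simp
  moreover have "inj_on \<pi> {y. E y \<in> W}"
    using W(3) DE by (auto simp: inj_on_def \<pi>_def) metis
  ultimately show thesis using W(2) that[of "{y. E y \<in> W}"] by simp
qed

lemma \<pi>_in_chart:
  assumes V: "(V, \<phi>) \<in> \<A>" and x: "\<pi> x \<in> V"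
  obtains A N where "A \<in> affine_transformations" "open N" "x \<in> N" "\<And>y. y \<in> N \<Longrightarrow> \<pi> y \<in> V"
    "\<And>y. y \<in> N \<Longrightarrow> \<phi> (\<pi> y) = A y"
proof -
  have "p (E x) \<in> V" using x by (simp add: \<pi>_def)
  then obtain T W where T: "T \<in> affine_transformations" and W: "openin C W" "E x \<in> W" "p ` W \<subseteq> V"
    and DT: "\<And>y. y \<in> W \<Longrightarrow> D y = T (\<phi> (p y))"
    using developing_in_chart[OF V E_in] by metis
  have "openin euclidean {y \<in> topspace euclidean. E y \<in> W}"
    by (rule openin_continuous_map_preimage[OF E_cont W(1)])
  then have o: "open {y. E y \<in> W}" by simp
  have "\<phi> (\<pi> y) = inv T y" if "E y \<in> W" for y
    using DT[OF that] DE[of y] affine_transformation_bij[OF T] by (metis \<pi>_def bij_inv_eq_iff)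
  then show thesis
    using that[of "inv T" "{y. E y \<in> W}"] affine_transformation_inv[OF T] o W by (auto simp: \<pi>_def)
qed

lemma closed_\<pi>_eq: "closed {x. \<pi> (f x) = \<pi> (g x)}" if "continuous_on UNIV f" "continuous_on UNIV g" for f g
proof -
  have "continuous_map euclidean M (\<pi> \<circ> f)" "continuous_map euclidean M (\<pi> \<circ> g)"
    using that by (auto intro: continuous_map_compose[OF _ \<pi>_cont])
  from closedin_continuous_maps_eq[OF Hausdorff this] show ?thesis by simp
qed

text \<open>Affine maps between two points of a fibre are read off in a common chart and then extended
  by analytic continuation.\<close>

lemma deck_transitive:
  assumes xy: "\<pi> x = \<pi> y"
  shows "\<exists>T \<in> deck. T x = y"
proof -
  obtain V \<phi> where V: "(V, \<phi>) \<in> \<A>" "\<pi> x \<in> V" using chart_at[OF \<pi>_in] by metis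
  have inj: "inj_on \<phi> V" by (rule chartD[OF V(1)])
  obtain A N1 where A: "A \<in> affine_transformations" "open N1" "x \<in> N1" "\<And>y. y \<in> N1 \<Longrightarrow> \<pi> y \<in> V"
    "\<And>y. y \<in> N1 \<Longrightarrow> \<phi> (\<pi> y) = A y"
    by (rule \<pi>_in_chart[OF V]) blast
  have yV: "\<pi> y \<in> V" using V xy by simp
  obtain B N2 where B: "B \<in> affine_transformations" "open N2" "y \<in> N2" "\<And>y. y \<in> N2 \<Longrightarrow> \<pi> y \<in> V"
    "\<And>y. y \<in> N2 \<Longrightarrow> \<phi> (\<pi> y) = B y"
    by (rule \<pi>_in_chart[OF V(1) yV]) blast
  define T where "T = inv B \<circ> A"
  have bijB: "bij B" by (rule affine_transformation_bij[OF B(1)])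
  have T: "T \<in> affine_transformations"
    unfolding T_def by (rule affine_transformation_compose[OF affine_transformation_inv[OF B(1)] A(1)])
  have BT: "B (T z) = A z" for z using bijB by (simp add: T_def bij_is_surj surj_f_inv_f)
  have "B (T x) = B y" using BT A(5)[OF A(3)] B(5)[OF B(3)] xy by simp
  then have Txy: "T x = y" using bijB by (simp add: bij_is_inj inj_eq)
  have contT: "continuous_on UNIV T" by (rule affine_transformation_continuous_on[OF T])
  \<comment> \<open>Asking for agreement on a neighbourhood makes \<open>S\<close> open by
    construction; the charts are needed for closedness.\<close>
  define S where "S = {z. \<exists>N. open N \<and> z \<in> N \<and> (\<forall>w \<in> N. \<pi> (T w) = \<pi> w)}"
  have "open S"
    unfolding S_def by (subst open_subopen) blast
  moreover have "closed S"
  proof -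
    have "closure S \<subseteq> S"
    proof
      fix z assume z: "z \<in> closure S"
      have "closure S \<subseteq> {x. \<pi> (T x) = \<pi> (id x)}"
        by (rule closure_minimal[OF _ closed_\<pi>_eq[OF contT continuous_on_id']]) (auto simp: S_def id_def)
      then have eqz: "\<pi> (T z) = \<pi> z" using z by auto
      obtain V \<phi> where V: "(V, \<phi>) \<in> \<A>" "\<pi> z \<in> V" using chart_at[OF \<pi>_in] by metis
      have inj: "inj_on \<phi> V" by (rule chartD[OF V(1)])
      obtain A N1 where A: "A \<in> affine_transformations" "open N1" "z \<in> N1" "\<And>y. y \<in> N1 \<Longrightarrow> \<pi> y \<in> V"
        "\<And>y. y \<in> N1 \<Longrightarrow> \<phi> (\<pi> y) = A y"
        by (rule \<pi>_in_chart[OF V]) blast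
      have TzV: "\<pi> (T z) \<in> V" using V eqz by simp
      obtain B N2 where B: "B \<in> affine_transformations" "open N2" "T z \<in> N2" "\<And>y. y \<in> N2 \<Longrightarrow> \<pi> y \<in> V"
        "\<And>y. y \<in> N2 \<Longrightarrow> \<phi> (\<pi> y) = B y"
        by (rule \<pi>_in_chart[OF V(1) TzV]) blast
      define N where "N = N1 \<inter> T -` N2"
      have N: "open N" "z \<in> N" using A B open_vimage[OF B(2) contT] by (auto simp: N_def)
      obtain s where s: "s \<in> S" "s \<in> N" using z N by (meson closure_iff_nhds_not_empty disjoint_iff order_refl)
      obtain N' where N': "open N'" "s \<in> N'" "\<And>w. w \<in> N' \<Longrightarrow> \<pi> (T w) = \<pi> w"
        using s(1) by (auto simp: S_def)
      \<comment> \<open>The affine identity holds near the point \<open>s\<close> of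
        \<open>S\<close>, hence everywhere; this carries the agreement to the whole neighbourhood
        \<open>N\<close> of \<open>z\<close>.\<close>
      have AB: "A = B \<circ> T"
      proof (rule affine_transformation_eq_on_open[OF A(1) affine_transformation_compose[OF B(1) T]])
        show "open (N \<inter> N')" "s \<in> N \<inter> N'" using N N' s by auto
        show "A w = (B \<circ> T) w" if "w \<in> N \<inter> N'" for w
          using A(5)[of w] B(5)[of "T w"] N'(3)[of w] that by (simp add: N_def)
      qed
      have "\<pi> (T w) = \<pi> w" if "w \<in> N" for w
        using A(4,5)[of w] B(4,5)[of "T w"] that by (intro inj_onD[OF inj]) (auto simp: N_def AB)
      then show "z \<in> S" using N by (auto simp: S_def)
    qed
    then show ?thesis by (simp add: closure_subset_eq)
  qed
  moreover have "x \<in> S"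
  proof -
    have "open (N1 \<inter> T -` N2)" "x \<in> N1 \<inter> T -` N2" using A B open_vimage[OF B(2) contT] Txy by auto
    moreover have "\<pi> (T w) = \<pi> w" if "w \<in> N1 \<inter> T -` N2" for w
      using A(4,5)[of w] B(4,5)[of "T w"] that BT[of w] by (intro inj_onD[OF inj]) auto
    ultimately show ?thesis by (auto simp: S_def)
  qed
  ultimately have "S = UNIV" using clopen[of S] by auto
  then have "\<pi> (T w) = \<pi> w" for w by (auto simp: S_def)
  then show ?thesis using T Txy by (auto simp: deck_def)
qed

lemma fibre_iff: "\<pi> x = \<pi> y \<longleftrightarrow> (\<exists>T \<in> deck. y = T x)"
  using deck_transitive by (auto simp: deck_def)

lemma deck_affine: "T \<in> deck \<Longrightarrow> T \<in> affine_transformations"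
  by (simp add: deck_def)

lemma deck_compose: "S \<in> deck \<Longrightarrow> T \<in> deck \<Longrightarrow> S \<circ> T \<in> deck"
  by (simp add: deck_def affine_transformation_compose)

lemma deck_inv: "T \<in> deck \<Longrightarrow> inv T \<in> deck"
proof -
  assume T: "T \<in> deck"
  have "T (inv T x) = x" for x
    using affine_transformation_bij[OF deck_affine[OF T]] by (simp add: bij_is_surj surj_f_inv_f)
  then have "\<pi> (inv T x) = \<pi> x" for x using T unfolding deck_def by (metis (mono_tags, lifting) mem_Collect_eq)
  then show "inv T \<in> deck" using affine_transformation_inv[OF deck_affine[OF T]] by (simp add: deck_def)
qed

text \<open>Near a fixed point both \<open>y\<close> and \<open>T y\<close> lie in a set on which
  \<open>\<pi>\<close> is injective, and \<open>T\<close> preserves the fibres of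
  \<open>\<pi>\<close>.\<close>

lemma deck_fixed_point:
  assumes T: "T \<in> deck" and x: "T x = x" shows "T = id"
proof -
  obtain N where N: "open N" "x \<in> N" "inj_on \<pi> N" by (rule \<pi>_locally_injective)
  have contT: "continuous_on UNIV T" by (rule affine_transformation_continuous_on[OF deck_affine[OF T]])
  show ?thesis
  proof (rule affine_transformation_eq_on_open[OF deck_affine[OF T] affine_transformation_id])
    show "open (N \<inter> T -` N)" "x \<in> N \<inter> T -` N" using N x open_vimage[OF N(1) contT] by auto
    show "T y = id y" if "y \<in> N \<inter> T -` N" for y
      using that N(3) T by (auto simp: deck_def dest: inj_onD)
  qed
qed

lemma deck_free:
  assumes S: "S \<in> deck" and T: "T \<in> deck" and eq: "S x = T x" shows "S = T"
proof -
  have b: "bij T" by (rule affine_transformation_bij[OF deck_affine[OF T]])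
  have "inv T \<circ> S = id"
    by (rule deck_fixed_point[OF deck_compose[OF deck_inv[OF T] S], of x]) (simp add: eq b bij_is_inj inv_f_f)
  then have "inv T (S y) = y" for y by (simp add: fun_eq_iff)
  then show ?thesis using b by (metis bij_inv_eq_iff ext)
qed

text \<open>An orbit lies in one fibre of \<open>\<pi>\<close>. An accumulation point would have a
  neighbourhood with infinitely many points of that fibre, against local injectivity.\<close>

lemma deck_discrete:
  assumes K: "compact K" shows "finite ((\<lambda>T. T x) ` deck \<inter> K)"
proof (rule ccontr)
  assume inf: "infinite ((\<lambda>T. T x) ` deck \<inter> K)"
  then obtain y where y: "y islimpt ((\<lambda>T. T x) ` deck \<inter> K)"
    using K Heine_Borel_imp_Bolzano_Weierstrass[OF K inf] by auto
  obtain N where N: "open N" "y \<in> N" "inj_on \<pi> N" by (rule \<pi>_locally_injective)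
  have "infinite (N \<inter> ((\<lambda>T. T x) ` deck \<inter> K))"
    using y N(1,2) by (simp add: islimpt_eq_acc_point)
  moreover have "a = b" if "a \<in> N \<inter> ((\<lambda>T. T x) ` deck \<inter> K)" "b \<in> N \<inter> ((\<lambda>T. T x) ` deck \<inter> K)" for a b
    using that N(3) by (auto simp: deck_def inj_on_def)
  then have "finite (N \<inter> ((\<lambda>T. T x) ` deck \<inter> K))"
    by (metis finite.simps infinite_imp_nonempty insertI1 ex_in_conv finite_subset[of _ "{_}"] subsetI singletonI)
  ultimately show False by blast
qed

lemma deck_cocompact:
  assumes "compact_space M"
  shows "\<exists>K. compact K \<and> (\<forall>x. \<exists>T \<in> deck. \<exists>y \<in> K. x = T y)"
proof -
  define \<U> where "\<U> = (\<lambda>n::nat. \<pi> ` ball 0 (real n)) ` UNIV"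
  have "openin M U" if "U \<in> \<U>" for U
    using that \<pi>_open by (auto simp: \<U>_def open_map_def)
  moreover have "topspace M \<subseteq> \<Union>\<U>"
  proof
    fix m assume "m \<in> topspace M"
    then obtain x where x: "m = \<pi> x" using \<pi>_surj by blast
    obtain n where "norm x < real n" using reals_Archimedean2 by blast
    then have "m \<in> \<pi> ` ball 0 (real n)" using x by simp
    then show "m \<in> \<Union>\<U>" unfolding \<U>_def by blast
  qed
  ultimately obtain \<F> where F: "finite \<F>" "\<F> \<subseteq> \<U>" "topspace M \<subseteq> \<Union>\<F>"
    using assms unfolding compact_space_alt by metis
  obtain I where I: "finite I" "\<F> = (\<lambda>n. \<pi> ` ball 0 (real n)) ` I"
    using finite_subset_image[OF F(1) F(2)[unfolded \<U>_def]] by blast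
  \<comment> \<open>Inserting 0 keeps \<open>Max\<close> defined without a separate case for empty
    \<open>I\<close>.\<close>
  define r where "r = real (Max (insert 0 I))"
  have le: "real n \<le> r" if "n \<in> I" for n using I(1) that by (simp add: r_def)
  have "\<exists>T \<in> deck. \<exists>y \<in> cball 0 r. x = T y" for x
  proof -
    obtain n y where n: "n \<in> I" "norm y < real n" "\<pi> x = \<pi> y"
      using F(3) \<pi>_in[of x] I(2) by auto
    then obtain T where "T \<in> deck" "x = T y" using fibre_iff[of y x] by auto
    then show ?thesis using n le[OF n(1)] by (intro bexI[of _ T] bexI[of _ y]) auto
  qed
  then show ?thesis by (intro exI[of _ "cball 0 r"]) auto
qed

section \<open>Holonomy, leaf topology and triviality of leaf stabilisers\<close>

lemma holonomy_eq:
  assumes h: "holonomy C p D h" and T: "T \<in> deck"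
  shows "\<exists>\<gamma> \<in> deck_transformations C p. h \<gamma> = T"
proof -
  define \<gamma> where "\<gamma> = E \<circ> T \<circ> D"
  have hom: "homeomorphic_maps C C (E \<circ> T \<circ> D) (E \<circ> inv T \<circ> D)"
  proof -
    have c: "continuous_map euclidean euclidean T" "continuous_map euclidean euclidean (inv T)"
      using affine_transformation_continuous_on deck_affine[OF T] affine_transformation_inv by auto
    show ?thesis unfolding homeomorphic_maps_def
      using continuous_map_compose[OF D_cont continuous_map_compose[OF c(1) E_cont]]
        continuous_map_compose[OF D_cont continuous_map_compose[OF c(2) E_cont]]
        affine_transformation_bij[OF deck_affine[OF T]]
      by (simp add: DE ED o_assoc bij_is_inj bij_is_surj inv_f_f surj_f_inv_f)
  qed
  have "p (\<gamma> x) = p x" if "x \<in> topspace C" for x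
    using T \<pi>_D[OF that] by (simp add: deck_def \<gamma>_def flip: \<pi>_def)
  then have \<gamma>: "\<gamma> \<in> deck_transformations C p"
    using hom homeomorphic_maps_imp_map unfolding deck_transformations_def \<gamma>_def by blast
  have "h \<gamma> x = T x" for x
  proof -
    have "D (\<gamma> (E x)) = h \<gamma> (D (E x))" using h \<gamma> E_in unfolding holonomy_def by blast
    then show ?thesis by (simp add: \<gamma>_def DE)
  qed
  then show ?thesis using \<gamma> by blast
qed

lemma deck_preserves:
  assumes h: "holonomy C p D h" and U: "holonomy_invariant_subspace C p h U"
    and T: "T \<in> deck" and u: "u \<in> U"
  shows "linear_part T u \<in> U"
  using holonomy_eq[OF h T] U u unfolding holonomy_invariant_subspace_def by blast

text \<open>It turns a homotopy inside a leaf into a homotopy in \<open>M\<close>, where the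
  covering \<open>p\<close> can lift it.\<close>

lemma leaf_topology_finer:
  "continuous_map (leaf_topology C p D U) M (\<lambda>x. x)"
  unfolding continuous_map
proof (intro conjI allI impI)
  have top: "topspace (leaf_topology C p D U) \<subseteq> topspace M"
    using p_surj openin_subset by (auto simp: leaf_topology_def) blast
  then show "(\<lambda>x. x) ` topspace (leaf_topology C p D U) \<subseteq> topspace M" by auto
  fix O' assume O: "openin M O'"
  have "openin (leaf_topology C p D U) (O' \<inter> topspace (leaf_topology C p D U))"
  proof (subst openin_subopen, intro ballI)
    fix m assume m: "m \<in> O' \<inter> topspace (leaf_topology C p D U)"
    then obtain W a x where W: "openin C W" "x \<in> W" "D x \<in> (+) a ` U" "m = p x"
      by (auto simp: leaf_topology_def)
    define W' where "W' = W \<inter> {x \<in> topspace C. p x \<in> O'}"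
    have "openin C W'" unfolding W'_def using W(1) openin_continuous_map_preimage[OF p_cont O] by blast
    then have o: "openin (leaf_topology C p D U) (p ` (W' \<inter> D -` ((+) a ` U)))"
      unfolding leaf_topology_def by (intro topology_generated_by_Basis) blast
    have mem: "m \<in> p ` (W' \<inter> D -` ((+) a ` U))"
      using W m openin_subset[OF W(1)] by (auto simp: W'_def)
    have sub: "p ` (W' \<inter> D -` ((+) a ` U)) \<subseteq> O'" by (auto simp: W'_def)
    show "\<exists>T. openin (leaf_topology C p D U) T \<and> m \<in> T \<and> T \<subseteq> O' \<inter> topspace (leaf_topology C p D U)"
      by (rule exI[of _ "p ` (W' \<inter> D -` ((+) a ` U))"]) (simp only: o mem sub openin_subset[OF o] Int_subset_iff simp_thms)
  qed
  moreover have "O' \<inter> topspace (leaf_topology C p D U) = {x \<in> topspace (leaf_topology C p D U). x \<in> O'}" by blast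
  ultimately show "openin (leaf_topology C p D U) {x \<in> topspace (leaf_topology C p D U). x \<in> O'}" by simp
qed

text \<open>Continuity is tested on the generating plaques. A plaque may be given by another sheet
  over the same point; an element of \<open>deck\<close> moves the segment to that sheet, and
  invariance of \<open>U\<close> keeps the moved segment parallel to \<open>U\<close>.\<close>

lemma segment_path_in_leaf:
  assumes h: "holonomy C p D h" and U: "holonomy_invariant_subspace C p h U" and v: "v \<in> U"
  shows "pathin (leaf_topology C p D U) (\<lambda>t. \<pi> (a + t *\<^sub>R v))"
  unfolding pathin_def leaf_topology_def
proof (rule continuous_on_generated_topo)
  have sU: "subspace U" using U by (simp add: holonomy_invariant_subspace_def)
  fix G assume "G \<in> {p ` (W \<inter> D -` ((+) a ` U)) |W a. openin C W}"
  then obtain W b where W: "openin C W" "G = p ` (W \<inter> D -` ((+) b ` U))" by blast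
  show "openin (top_of_set {0..1}) ((\<lambda>t. \<pi> (a + t *\<^sub>R v)) -` G \<inter> topspace (top_of_set {0..1}))"
  proof (subst openin_subopen, intro ballI)
    fix t assume "t \<in> (\<lambda>t. \<pi> (a + t *\<^sub>R v)) -` G \<inter> topspace (top_of_set {0..1})"
    then obtain w u where t: "t \<in> {0..1}" and w: "w \<in> W" "D w = b + u" "u \<in> U" "\<pi> (a + t *\<^sub>R v) = p w"
      using W(2) by auto
    have wC: "w \<in> topspace C" using w(1) openin_subset[OF W(1)] by blast
    \<comment> \<open>\<open>w\<close> need not be \<open>E (a + t *\<^sub>R v)\<close>, but it lies
      over the same point of \<open>M\<close>.\<close>
    then obtain T where T: "T \<in> deck" "D w = T (a + t *\<^sub>R v)"
      using w(4) \<pi>_D fibre_iff[of "a + t *\<^sub>R v" "D w"] by auto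
    have contT: "continuous_on UNIV T" by (rule affine_transformation_continuous_on[OF deck_affine[OF T(1)]])
    define N where "N = {s \<in> topspace euclideanreal. (E \<circ> (\<lambda>s. T (a + s *\<^sub>R v))) s \<in> W}"
    have "continuous_map euclideanreal euclidean (\<lambda>s. T (a + s *\<^sub>R v))"
      by (auto intro!: continuous_on_compose2[OF contT] continuous_intros)
    from continuous_map_compose[OF this E_cont]
    have N: "openin euclideanreal N" unfolding N_def by (rule openin_continuous_map_preimage) (rule W(1))
    have tN: "t \<in> N" using w(1) ED[OF wC] T(2) by (simp add: N_def)
    have "\<pi> (a + s *\<^sub>R v) \<in> G" if s: "s \<in> N" for s
    proof -
      have "T (a + s *\<^sub>R v) - T (a + t *\<^sub>R v) = linear_part T ((a + s *\<^sub>R v) - (a + t *\<^sub>R v))"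
        by (rule affine_transformation_linear_part(2)[OF deck_affine[OF T(1)]])
      also have "(a + s *\<^sub>R v) - (a + t *\<^sub>R v) = (s - t) *\<^sub>R v" by (simp add: algebra_simps)
      finally have "T (a + s *\<^sub>R v) = b + (u + linear_part T ((s - t) *\<^sub>R v))"
        using T(2) w(2) by (simp add: algebra_simps)
      moreover have "u + linear_part T ((s - t) *\<^sub>R v) \<in> U"
        using deck_preserves[OF h U T(1)] v w(3) sU by (simp add: subspace_add subspace_scale)
      ultimately have "D (E (T (a + s *\<^sub>R v))) \<in> (+) b ` U" unfolding DE by blast
      moreover have "E (T (a + s *\<^sub>R v)) \<in> W" using s by (simp add: N_def)
      ultimately have "p (E (T (a + s *\<^sub>R v))) \<in> G" using W(2) by blast
      then show ?thesis using T(1) by (simp add: deck_def flip: \<pi>_def)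
    qed
    then show "\<exists>T. openin (top_of_set {0..1}) T \<and> t \<in> T \<and>
        T \<subseteq> (\<lambda>t. \<pi> (a + t *\<^sub>R v)) -` G \<inter> topspace (top_of_set {0..1})"
      using N tN t by (intro exI[of _ "{0..1} \<inter> N"]) (auto intro: openin_open_Int)
  qed
next
  have sU: "subspace U" using U by (simp add: holonomy_invariant_subspace_def)
  show "(\<lambda>t. \<pi> (a + t *\<^sub>R v)) ` topspace (top_of_set {0..1}) \<subseteq> \<Union> {p ` (W \<inter> D -` ((+) a ` U)) |W a. openin C W}"
  proof
    fix m assume "m \<in> (\<lambda>t. \<pi> (a + t *\<^sub>R v)) ` topspace (top_of_set {0..1})"
    then obtain t where m: "m = \<pi> (a + t *\<^sub>R v)" by blast
    have "t *\<^sub>R v \<in> U" using sU v by (rule subspace_scale)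
    then have "m \<in> p ` (topspace C \<inter> D -` ((+) a ` U))"
      unfolding m \<pi>_def by (intro imageI) (simp add: E_in DE)
    then show "m \<in> \<Union> {p ` (W \<inter> D -` ((+) a ` U)) |W a. openin C W}" by blast
  qed
qed

text \<open>The homotopy supplied by simple connectedness is free, so its base point moves along
  \<open>k (r, 0)\<close>. Comparing the ends of the lifted loops \<open>G r\<close> with a lift
  \<open>l\<close> of this track shows that closedness of the lift passes from the constant loop at
  \<open>r = 1\<close> back to the loop at \<open>r = 0\<close>.\<close>

lemma leaf_stabilizer_trivial:
  assumes h: "holonomy C p D h" and U: "holonomy_invariant_subspace C p h U"
    and sc: "\<And>F. F \<in> leaves C p D U \<Longrightarrow> simply_connected_space (leaf_space C p D U F)"
    and T: "T \<in> deck" and Ta: "T a - a \<in> U"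
  shows "T = id"
proof -
  define v where "v = T a - a"
  define X where "X = leaf_topology C p D U"
  define f where "f t = \<pi> (a + t *\<^sub>R v)" for t
  have f: "pathin X f" unfolding X_def f_def v_def by (rule segment_path_in_leaf[OF h U Ta])
  have f01: "f 0 = \<pi> a" "f 1 = \<pi> a" using T by (simp_all add: f_def v_def deck_def)
  define F where "F = path_component_of_set X (\<pi> a)"
  have aX: "\<pi> a \<in> topspace X" using f f01 continuous_map_image_subset_topspace unfolding pathin_def by fastforce
  have F: "F \<in> leaves C p D U" unfolding leaves_def F_def X_def[symmetric] path_components_of_def using aX by blast
  have "f ` {0..1} \<subseteq> F"
  proof (rule path_components_of_maximal)
    show "F \<in> path_components_of X" using F by (simp add: leaves_def X_def)
    show "path_connectedin X (f ` {0..1})" by (rule path_connectedin_path_image[OF f])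
    have "\<pi> a \<in> F" unfolding F_def using aX by (simp add: path_component_of_refl)
    moreover have "\<pi> a \<in> f ` {0..1}" by (rule image_eqI[of _ _ 0]) (simp_all add: f01)
    ultimately show "\<not> disjnt F (f ` {0..1})" by (auto simp: disjnt_iff)
  qed
  then have fF: "pathin (leaf_space C p D U F) f"
    using f by (auto simp: leaf_space_def pathin_subtopology X_def)
  have "pathin (leaf_space C p D U F) (\<lambda>_. \<pi> a)"
    using fF f01 continuous_map_image_subset_topspace unfolding pathin_def by fastforce
  then have "homotopic_with (\<lambda>r. r 1 = r 0) (top_of_set {0..1::real}) (leaf_space C p D U F) f (\<lambda>_. \<pi> a)"
    using sc[OF F] fF f01 unfolding simply_connected_space_def by auto
  then obtain k where "continuous_map (prod_topology (top_of_set {0..1::real}) (top_of_set {0..1::real})) (leaf_space C p D U F) k"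
    "\<forall>t. k (0, t) = f t" "\<forall>t. k (1, t) = \<pi> a" "\<forall>r \<in> {0..1}. k (r, 1) = k (r, 0)"
    unfolding homotopic_with_def by (elim exE conjE)
  note k = this[rule_format]
  have "continuous_map (leaf_space C p D U F) M (\<lambda>x. x)"
    unfolding leaf_space_def by (rule continuous_map_from_subtopology[OF leaf_topology_finer])
  from continuous_map_compose[OF k(1) this]
  have kM: "continuous_map (prod_topology (top_of_set {0..1}) (top_of_set {0..1})) M k" by (simp add: o_def)
  have slice: "continuous_map (top_of_set {0..1}) M (\<lambda>t. k (r, t))" if r: "r \<in> {0..1}" for r
  proof -
    have "continuous_map (top_of_set {0..1}) (prod_topology (top_of_set {0..1}) (top_of_set {0..1})) (\<lambda>t. (r, t))"
      using r by (intro continuous_map_pairedI) auto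
    from continuous_map_compose[OF this kM] show ?thesis by (simp add: o_def)
  qed
  have "continuous_map (top_of_set {0..1}) (prod_topology (top_of_set {0..1}) (top_of_set {0..1})) (\<lambda>r. (r, 0::real))"
    by (intro continuous_map_pairedI) auto
  from continuous_map_compose[OF this kM]
  have k0: "continuous_map (top_of_set {0..1}) M (\<lambda>r. k (r, 0))" by (simp add: o_def)
  have "p (E a) = k (0, 0)" using k(2) f01 by (simp add: \<pi>_def)
  then obtain l where l: "continuous_map (top_of_set {0..1}) C l" "l 0 = E a" "\<And>r. r \<in> {0..1} \<Longrightarrow> p (l r) = k (r, 0)"
    using path_lifting[OF covering k0 E_in] by metis
  have lC: "l r \<in> topspace C" if "r \<in> {0..1}" for r
    using l(1) that continuous_map_image_subset_topspace by fastforce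
  have "\<exists>g. continuous_map (top_of_set {0..1}) C g \<and> g 0 = l r \<and> (\<forall>t \<in> {0..1}. p (g t) = k (r, t))" if r: "r \<in> {0..1}" for r
    by (rule path_lifting[OF covering slice[OF r] lC[OF r] l(3)[OF r]])
  then obtain G where G: "\<And>r. r \<in> {0..1} \<Longrightarrow> continuous_map (top_of_set {0..1}) C (G r)"
    "\<And>r. r \<in> {0..1} \<Longrightarrow> G r 0 = l r" "\<And>r t. r \<in> {0..1} \<Longrightarrow> t \<in> {0..1} \<Longrightarrow> p (G r t) = k (r, t)"
    by metis
  have G1: "continuous_map (top_of_set {0..1}) C (\<lambda>r. G r 1)"
  proof (rule end_of_lift_continuous[OF p_local_homeomorphism C_Hausdorff])
    show "continuous_map (prod_topology (top_of_set {0..1}) (top_of_set {0..1})) M (\<lambda>(r, t). p (G r t))"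
      by (rule continuous_map_eq[OF kM]) (auto simp: G(3))
    show "continuous_map (top_of_set {0..1}) C (\<lambda>r. G r 0)"
      by (rule continuous_map_eq[OF l(1)]) (auto simp: G(2))
  qed (use G(1) in auto)
  have p_inj: "\<And>y. y \<in> topspace C \<Longrightarrow> \<exists>W. openin C W \<and> y \<in> W \<and> inj_on p W"
    using p_local_homeomorphism unfolding local_homeomorphism_def by blast
  have conn: "connected_space (top_of_set {0..1::real})"
    by (simp add: connected_space_subtopology connectedin_subtopology flip: connectedin_topspace)
  \<comment> \<open>At \<open>r = 1\<close> the loop is constant, and so is its lift.\<close>
  have "G 1 1 = l 1"
  proof (rule unique_lift[OF conn C_Hausdorff p_inj, where f = "G 1" and g = "\<lambda>_. l 1" and ?z0.0 = 0 and z = 1])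
    show "p (G 1 t) = p (l 1)" if "t \<in> topspace (top_of_set {0..1})" for t
      using that G(3)[of 1 t] l(3)[of 1] k(3) by simp
  qed (use G(1,2) lC in auto)
  \<comment> \<open>\<open>G r 1\<close> and \<open>l r\<close> lift the same track, since every
    \<open>k (r, _)\<close> is a loop, and they agree at \<open>r = 1\<close>.\<close>
  have "G 0 1 = l 0"
  proof (rule unique_lift[OF conn C_Hausdorff p_inj G1 l(1), where ?z0.0 = 1 and z = 0])
    show "p (G r 1) = p (l r)" if "r \<in> topspace (top_of_set {0..1})" for r
      using that G(3)[of r 1] l(3)[of r] k(4)[of r] by simp
  qed (use \<open>G 1 1 = l 1\<close> in auto)
  \<comment> \<open>The original loop lifts to the image under \<open>E\<close> of the segment from
    \<open>a\<close> to \<open>T a\<close>.\<close>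
  moreover have "G 0 1 = E (a + 1 *\<^sub>R v)"
  proof (rule unique_lift[OF conn C_Hausdorff p_inj, where f = "G 0" and g = "\<lambda>t. E (a + t *\<^sub>R v)" and ?z0.0 = 0 and z = 1])
    have "continuous_map (top_of_set {0..1}) euclidean (\<lambda>t. a + t *\<^sub>R v)" by (auto intro!: continuous_intros)
    from continuous_map_compose[OF this E_cont]
    show "continuous_map (top_of_set {0..1}) C (\<lambda>t. E (a + t *\<^sub>R v))" by (simp add: o_def)
    show "p (G 0 t) = p (E (a + t *\<^sub>R v))" if "t \<in> topspace (top_of_set {0..1})" for t
      using that G(3)[of 0 t] k(2)[of t] by (simp add: f_def \<pi>_def)
  qed (use G(1,2) l(2) in auto)
  ultimately have "E (T a) = E a" using l(2) by (simp add: v_def)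
  then have "T a = a" using DE by metis
  then show ?thesis by (rule deck_fixed_point[OF T])
qed

lemma deck_commute:
  assumes h: "holonomy C p D h" and U: "holonomy_invariant_subspace C p h U"
    and sc: "\<And>F. F \<in> leaves C p D U \<Longrightarrow> simply_connected_space (leaf_space C p D U F)"
    and dim: "CARD('n) = dim U + 1"
    and S: "S \<in> deck" and T: "T \<in> deck"
  shows "S (T x) = T (S x)"
proof -
  have sU: "subspace U" using U by (simp add: holonomy_invariant_subspace_def)
  have "dim U = DIM(real^'n) - 1" using dim by simp
  \<comment> \<open>\<open>f\<close> is a normal of the hyperplane \<open>U\<close>, so
    \<open>f \<bullet> x\<close> is the coordinate of \<open>x\<close> on the quotient line.\<close>
  then obtain f where f: "f \<noteq> 0" "span U = {x. f \<bullet> x = 0}" unfolding dim_eq_hyperplane by blast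
  have Uf: "u \<in> U \<longleftrightarrow> f \<bullet> u = 0" for u using f(2) span_eq_iff[THEN iffD2, OF sU] by auto
  define e where "e = f /\<^sub>R (f \<bullet> f)"
  have e: "f \<bullet> e = 1" using f(1) by (simp add: e_def)
  have trivial: "T = id" if "T \<in> deck" "f \<bullet> (T a - a) = 0" for T a
    using leaf_stabilizer_trivial[OF h U sc that(1), of a] that(2) Uf by blast
  text \<open>On the leaf space \<open>\<real>\<^sup>n / U \<cong> \<real>\<close> the group acts by affine maps of the line without fixed points,
    hence by translations.\<close>
  have transl: "f \<bullet> (T x - x) = f \<bullet> T 0" if T: "T \<in> deck" for T x
  proof -
    define L where "L = linear_part T"
    have L: "linear L" "\<And>x y. T x - T y = L (x - y)"
      unfolding L_def using affine_transformation_linear_part[OF deck_affine[OF T]] by auto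
    define c where "c = f \<bullet> L e"
    have fL: "f \<bullet> L y = c * (f \<bullet> y)" for y
    proof -
      have "y - (f \<bullet> y) *\<^sub>R e \<in> U" using e by (simp add: Uf inner_diff_right)
      then have "L (y - (f \<bullet> y) *\<^sub>R e) \<in> U" unfolding L_def by (rule deck_preserves[OF h U T])
      then show ?thesis using L(1) by (simp add: Uf inner_diff_right linear_diff linear_scale c_def)
    qed
    have fT: "f \<bullet> T y = c * (f \<bullet> y) + f \<bullet> T 0" for y
    proof -
      have "T y = L y + T 0" using L(2)[of y 0] by (simp add: diff_eq_eq)
      then have "f \<bullet> T y = f \<bullet> (L y + T 0)" by (rule arg_cong)
      then show ?thesis by (simp only: inner_add_right fL)
    qed
    have "c = 1"
    proof (rule ccontr)
      assume c: "c \<noteq> 1"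
      \<comment> \<open>A point over the fixed point of
        \<open>s \<mapsto> c * s + f \<bullet> T 0\<close>, which exists because
        \<open>c \<noteq> 1\<close>.\<close>
      define a where "a = (f \<bullet> T 0 / (1 - c)) *\<^sub>R e"
      have "f \<bullet> a = f \<bullet> T 0 / (1 - c)" using e by (simp add: a_def)
      then have "f \<bullet> (T a - a) = 0"
        using c unfolding inner_diff_right fT[of a] by (simp add: field_simps)
      then have "T = id" by (rule trivial[OF T])
      then have "c = 1" using fT[of e] e by simp
      then show False using c by simp
    qed
    then show ?thesis using fT[of x] by (simp add: inner_diff_right)
  qed
  \<comment> \<open>Translations of the line commute, so the commutator \<open>R\<close> preserves
    the hyperplane through \<open>T (S x)\<close> and is trivial.\<close>
  define R where "R = (S \<circ> T) \<circ> inv (T \<circ> S)"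
  have R: "R \<in> deck" unfolding R_def by (intro deck_compose deck_inv S T)
  have Ry: "R (T (S x)) = S (T x)"
    using affine_transformation_bij[OF deck_affine[OF deck_compose[OF T S]]]
    by (simp add: R_def) (metis bij_inv_eq_iff o_apply)
  have "f \<bullet> (R (T (S x)) - T (S x)) = 0"
    using transl[OF S, of "T x"] transl[OF T, of "S x"] transl[OF S, of x] transl[OF T, of x]
    by (simp add: Ry inner_diff_right)
  then have "R = id" by (rule trivial[OF R])
  then show ?thesis using Ry by simp
qed

end

theorem proposition4p4:
  fixes M :: "'a topology"
    and \<A> \<O> :: "('a, 'n::finite) chart set"
    and C :: "'b topology"
    and p :: "'b \<Rightarrow> 'a"
    and D :: "'b \<Rightarrow> real^'n"
    and h :: "('b \<Rightarrow> 'b) \<Rightarrow> real^'n \<Rightarrow> real^'n"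
    and U :: "(real^'n) set"
  assumes "affine_manifold M \<A>"
    and "compact_space M"
    and "affine_orientation M \<A> \<O>"
    and "geodesically_complete M \<A>"
    and "universal_cover C p M"
    and "developing_map \<A> C p D"
    and "holonomy C p D h"
    and "holonomy_invariant_subspace C p h U"
    and "CARD('n) = dim U + 1"
    and "\<And>F. F \<in> leaves C p D U \<Longrightarrow> simply_connected_space (leaf_space C p D U F)"
  shows "M homeomorphic_space (torus :: ('n \<Rightarrow> complex) topology)"
proof -
  interpret complete_affine_manifold M \<A> C p D
    using assms(1,4-6) by unfold_locales (auto simp: affine_manifold_def atlas_with_def)
  obtain E where "homeomorphic_maps C euclidean D E" by (rule developing_homeomorphism)
  then interpret developed_affine_manifold M \<A> C p D E by unfold_locales
  have "crystallographic_action deck"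
  proof (rule crystallographic_action.intro)
    show "linear (\<lambda>v. T v - T 0)" if "T \<in> deck" for T
      using affine_transformation_linear_part(1)[OF deck_affine[OF that]] by (simp add: linear_part_def)
    show "bij T \<and> inv T \<in> deck" if "T \<in> deck" for T
      using affine_transformation_bij[OF deck_affine[OF that]] deck_inv[OF that] by simp
    show "deck \<noteq> {}" using affine_transformation_id by (auto simp: deck_def)
    show "S (T x) = T (S x)" if "S \<in> deck" "T \<in> deck" for S T x
      by (rule deck_commute[OF assms(7,8,10,9) that])
  qed (use deck_compose deck_free deck_discrete deck_cocompact[OF assms(2)] in blast)+
  then show ?thesis
    by (rule crystallographic_quotient_torus[OF _ \<pi>_cont \<pi>_open \<pi>_surj assms(2) fibre_iff])
qed

end
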